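(* Let $M$ be a W$^*$-algebra with a faithful normal trace state $\tau$. Let $1 \in B \subset M$ be a W$^*$-subalgebra, and let $1 \in A, C \subset M$ be $*$-subalgebras. Assume that $A$ and $C$ are $B$-free in $(M,E_B)$. Then there is a holomorphic function $F:\mathbb{H}_+(A) \times \mathbb{H}_+(C) \to B$ such that $$E_{A \vee B}\left((a+c)^{-1}\right) = (a + F(a,c))^{-1}$$ for all $a \in \mathbb{H}_+(A)$, $c \in \mathbb{H}_+(C)$.
   Context: $A\vee B$ denotes the algebra generated (algebraically) by $A \cup B$. For a $*$-subalgebra $1\in N\subset M$, $E_N$ denotes the canonical $\tau$-preserving conditional expectation of $M$ onto $W^*(N)$, the von Neumann algebra generated by $N$. "$A$ and $C$ are $B$-free in $(M,E_B)$" means that $A\vee B$ and $B\vee C$ are free with amalgamation over $B$ with respect to $E_B$. For a unital $*$-subalgebra $N\subset M$, $\mathbb{H}_+(N)=\{T\in N : \operatorname{Im} T\ge \epsilon 1 \text{ for some } \epsilon>0\}$, where $\operatorname{Im}T=(T-T^* )/(2i)$; it is an open subset of $N$ in the uniform norm. Holomorphic is meant with respect to the uniform norms. The identity includes the assertion that $a+F(a,c)$ is invertible. *)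

theory Defs
  imports "HOL-Analysis.Analysis"
begin

section \<open>Unital complex C*-algebras\<close>

text \<open>The C*-algebra is a whole type. The superclass \<^class>\<open>real_normed_algebra_1\<close> contains
  \<open>norm 1 = 1\<close>, which only excludes the zero algebra (it carries no state).\<close>

class cstar_algebra = real_normed_algebra_1 + banach +
  fixes scaleC :: "complex \<Rightarrow> 'a \<Rightarrow> 'a" (infixr "*\<^sub>C" 75)
    and star :: "'a \<Rightarrow> 'a"
  assumes scaleC_add_right: "c *\<^sub>C (x + y) = c *\<^sub>C x + c *\<^sub>C y"
    and scaleC_add_left: "(c + d) *\<^sub>C x = c *\<^sub>C x + d *\<^sub>C x"
    and scaleC_scaleC: "c *\<^sub>C (d *\<^sub>C x) = (c * d) *\<^sub>C x"
    and scaleC_of_real: "complex_of_real r *\<^sub>C x = r *\<^sub>R x"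
    and mult_scaleC_left: "(c *\<^sub>C x) * y = c *\<^sub>C (x * y)"
    and mult_scaleC_right: "x * (c *\<^sub>C y) = c *\<^sub>C (x * y)"
    and norm_scaleC: "norm (c *\<^sub>C x) = cmod c * norm x"
    and star_star: "star (star x) = x"
    and star_add: "star (x + y) = star x + star y"
    and star_scaleC: "star (c *\<^sub>C x) = cnj c *\<^sub>C star x"
    and star_mult: "star (x * y) = star y * star x"
    and cstar_identity: "norm (star x * x) = (norm x)\<^sup>2"

definition positive_elem :: "'a::cstar_algebra \<Rightarrow> bool" where
  "positive_elem x \<longleftrightarrow> (\<exists>y. x = star y * y)"

definition Im_part :: "'a::cstar_algebra \<Rightarrow> 'a" where
  "Im_part T = (1 / (2 * \<i>)) *\<^sub>C (T - star T)"

definition two_sided_inverse :: "'a::cstar_algebra \<Rightarrow> 'a \<Rightarrow> bool" where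
  "two_sided_inverse x y \<longleftrightarrow> x * y = 1 \<and> y * x = 1"

definition invertible_elem :: "'a::cstar_algebra \<Rightarrow> bool" where
  "invertible_elem x \<longleftrightarrow> (\<exists>y. two_sided_inverse x y)"

text \<open>Only meaningful for invertible arguments.\<close>
definition inv_elem :: "'a::cstar_algebra \<Rightarrow> 'a" where
  "inv_elem x = (THE y. two_sided_inverse x y)"

definition star_subalgebra :: "'a::cstar_algebra set \<Rightarrow> bool" where
  "star_subalgebra N \<longleftrightarrow>
     1 \<in> N \<and> (\<forall>x\<in>N. \<forall>y\<in>N. x + y \<in> N \<and> x * y \<in> N) \<and>
     (\<forall>c. \<forall>x\<in>N. c *\<^sub>C x \<in> N) \<and> (\<forall>x\<in>N. star x \<in> N)"

definition subalgebra :: "'a::cstar_algebra set \<Rightarrow> bool" where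
  "subalgebra N \<longleftrightarrow>
     0 \<in> N \<and> (\<forall>x\<in>N. \<forall>y\<in>N. x + y \<in> N \<and> x * y \<in> N) \<and> (\<forall>c. \<forall>x\<in>N. c *\<^sub>C x \<in> N)"

text \<open>The algebra generated by \<open>A \<union> B\<close>, with no closure.\<close>
definition alg_join :: "'a::cstar_algebra set \<Rightarrow> 'a set \<Rightarrow> 'a set" (infixl "\<squnion>\<^sub>a" 65) where
  "A \<squnion>\<^sub>a B = subalgebra hull (A \<union> B)"

definition upper_half :: "'a::cstar_algebra set \<Rightarrow> 'a set" ("\<H>\<^sub>+") where
  "\<H>\<^sub>+ N = {T \<in> N. \<exists>\<epsilon>>0. positive_elem (Im_part T - \<epsilon> *\<^sub>R 1)}"


section \<open>Complex Hilbert spaces\<close>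

text \<open>\<open>cinner\<close> is linear in the second argument; its real part is the inner product of the
  superclass, so that the library's norm is the Hilbert space norm.\<close>

class complex_hilbert = real_inner + complete_space +
  fixes scaleH :: "complex \<Rightarrow> 'a \<Rightarrow> 'a" (infixr "*\<^sub>H" 75)
    and cinner :: "'a \<Rightarrow> 'a \<Rightarrow> complex"
  assumes scaleH_add_right: "c *\<^sub>H (u + v) = c *\<^sub>H u + c *\<^sub>H v"
    and scaleH_add_left: "(c + d) *\<^sub>H u = c *\<^sub>H u + d *\<^sub>H u"
    and scaleH_scaleH: "c *\<^sub>H (d *\<^sub>H u) = (c * d) *\<^sub>H u"
    and scaleH_of_real: "complex_of_real r *\<^sub>H u = r *\<^sub>R u"
    and cinner_add_right: "cinner u (v + w) = cinner u v + cinner u w"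
    and cinner_scaleH_right: "cinner u (c *\<^sub>H v) = c * cinner u v"
    and cinner_commute: "cinner u v = cnj (cinner v u)"
    and inner_eq_Re_cinner: "inner u v = Re (cinner u v)"


section \<open>W*-algebras, normal traces, conditional expectations\<close>

definition l2_seq :: "(nat \<Rightarrow> 'h::complex_hilbert) \<Rightarrow> bool" where
  "l2_seq \<xi> \<longleftrightarrow> summable (\<lambda>n. (norm (\<xi> n))\<^sup>2)"

definition vec_functional ::
  "(nat \<Rightarrow> 'h::complex_hilbert) \<Rightarrow> (nat \<Rightarrow> 'h) \<Rightarrow> ('h \<Rightarrow>\<^sub>L 'h) \<Rightarrow> complex" where
  "vec_functional \<xi> \<eta> T = (\<Sum>n. cinner (\<xi> n) (T (\<eta> n)))"

text \<open>The type \<open>'h \<Rightarrow>\<^sub>L 'h\<close> consists of the bounded real-linear operators. \<open>B(H)\<close> is the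
  subset of complex-linear ones; it is closed in the following topology, which restricts to the
  ultraweak (\<open>\<sigma>\<close>-weak) topology of \<open>B(H)\<close>. A closed set of complex-linear operators is
  therefore the same as an ultraweakly closed subset of \<open>B(H)\<close>.\<close>
definition ultraweak :: "('h::complex_hilbert \<Rightarrow>\<^sub>L 'h) topology" where
  "ultraweak = topology_generated_by
     {vec_functional \<xi> \<eta> -` U |\<xi> \<eta> U. l2_seq \<xi> \<and> l2_seq \<eta> \<and> open U}"

text \<open>Unital *-subalgebras \<open>N\<close> that are ultraweakly closed in the representation \<open>\<pi>\<close>.\<close>
definition wstar_subalgebra ::
  "('a::cstar_algebra \<Rightarrow> 'h::complex_hilbert \<Rightarrow>\<^sub>L 'h) \<Rightarrow> 'a set \<Rightarrow> bool" where
  "wstar_subalgebra \<pi> N \<longleftrightarrow> star_subalgebra N \<and> closedin ultraweak (\<pi> ` N)"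

text \<open>The C*-algebra \<open>'a\<close> is a W*-algebra: \<open>\<pi>\<close> is an isometric unital *-isomorphism onto a
  von Neumann algebra on the Hilbert space \<open>'h\<close>.\<close>
definition wstar_algebra ::
  "('a::cstar_algebra \<Rightarrow> 'h::complex_hilbert \<Rightarrow>\<^sub>L 'h) \<Rightarrow> bool" where
  "wstar_algebra \<pi> \<longleftrightarrow>
     (\<forall>x c v. \<pi> x (c *\<^sub>H v) = c *\<^sub>H \<pi> x v) \<and>
     (\<forall>x y. \<pi> (x + y) = \<pi> x + \<pi> y) \<and> (\<forall>c x v. \<pi> (c *\<^sub>C x) v = c *\<^sub>H \<pi> x v) \<and>
     (\<forall>x y. \<pi> (x * y) = \<pi> x o\<^sub>L \<pi> y) \<and> \<pi> 1 = id_blinfun \<and>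
     (\<forall>x u v. cinner (\<pi> (star x) u) v = cinner u (\<pi> x v)) \<and>
     (\<forall>x. norm (\<pi> x) = norm x) \<and>
     closedin ultraweak (range \<pi>)"

definition wstar_generated ::
  "('a::cstar_algebra \<Rightarrow> 'h::complex_hilbert \<Rightarrow>\<^sub>L 'h) \<Rightarrow> 'a set \<Rightarrow> 'a set" where
  "wstar_generated \<pi> N = wstar_subalgebra \<pi> hull N"

text \<open>A functional is normal if it is ultraweakly continuous, i.e. given by two
  square-summable sequences of vectors.\<close>
definition normal_functional ::
  "('a::cstar_algebra \<Rightarrow> 'h::complex_hilbert \<Rightarrow>\<^sub>L 'h) \<Rightarrow> ('a \<Rightarrow> complex) \<Rightarrow> bool" where
  "normal_functional \<pi> \<phi> \<longleftrightarrow>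
     (\<exists>\<xi> \<eta>. l2_seq \<xi> \<and> l2_seq \<eta> \<and> (\<forall>x. \<phi> x = vec_functional \<xi> \<eta> (\<pi> x)))"

definition faithful_normal_trace_state ::
  "('a::cstar_algebra \<Rightarrow> 'h::complex_hilbert \<Rightarrow>\<^sub>L 'h) \<Rightarrow> ('a \<Rightarrow> complex) \<Rightarrow> bool" where
  "faithful_normal_trace_state \<pi> \<tau> \<longleftrightarrow>
     (\<forall>x y. \<tau> (x + y) = \<tau> x + \<tau> y) \<and> (\<forall>c x. \<tau> (c *\<^sub>C x) = c * \<tau> x) \<and>
     \<tau> 1 = 1 \<and> (\<forall>x. \<tau> (star x * x) \<in> \<real>\<^sub>\<ge>\<^sub>0) \<and>
     (\<forall>x. \<tau> (star x * x) = 0 \<longrightarrow> x = 0) \<and>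
     (\<forall>x y. \<tau> (x * y) = \<tau> (y * x)) \<and>
     normal_functional \<pi> \<tau>"

text \<open>\<open>E\<close> is the \<open>\<tau>\<close>-preserving conditional expectation \<open>E\<^sub>N\<close> onto the W*-algebra generated
  by \<open>N\<close>. For a faithful normal trace state it exists (Umegaki), and it is unique: see
  \<open>cond_exp_unique\<close> below.\<close>
definition cond_exp ::
  "('a::cstar_algebra \<Rightarrow> 'h::complex_hilbert \<Rightarrow>\<^sub>L 'h) \<Rightarrow> ('a \<Rightarrow> complex) \<Rightarrow> 'a set \<Rightarrow>
    ('a \<Rightarrow> 'a) \<Rightarrow> bool" where
  "cond_exp \<pi> \<tau> N E \<longleftrightarrow>
     (\<forall>x. E x \<in> wstar_generated \<pi> N) \<and> (\<forall>y\<in>wstar_generated \<pi> N. E y = y) \<and>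
     (\<forall>x y. E (x + y) = E x + E y) \<and> (\<forall>c x. E (c *\<^sub>C x) = c *\<^sub>C E x) \<and>
     (\<forall>x. positive_elem x \<longrightarrow> positive_elem (E x)) \<and>
     (\<forall>y\<in>wstar_generated \<pi> N. \<forall>z\<in>wstar_generated \<pi> N. \<forall>x. E (y * x * z) = y * E x * z) \<and>
     (\<forall>x. \<tau> (E x) = \<tau> x)"

lemma star_subalgebra_wstar_generated: "star_subalgebra (wstar_generated \<pi> N)"
  unfolding wstar_generated_def hull_def wstar_subalgebra_def star_subalgebra_def by blast

lemma cond_exp_unique:
  fixes \<tau> :: "'a::cstar_algebra \<Rightarrow> complex"
  assumes tau: "faithful_normal_trace_state \<pi> \<tau>"
    and E: "cond_exp \<pi> \<tau> N E" and E': "cond_exp \<pi> \<tau> N E'"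
  shows "E = E'"
proof
  fix x
  let ?W = "wstar_generated \<pi> N"
  have W: "star_subalgebra ?W" by (rule star_subalgebra_wstar_generated)
  have one: "1 \<in> ?W" using W by (simp add: star_subalgebra_def)
  define d where "d = E x - E' x"
  have m1: "(-1) *\<^sub>C z = - z" for z :: 'a
    using scaleC_of_real[of "-1" z] by simp
  have ran: "E x \<in> ?W" "E' x \<in> ?W"
    using E E' by (simp_all add: cond_exp_def)
  then have "(-1) *\<^sub>C E' x \<in> ?W"
    using W by (simp add: star_subalgebra_def)
  with ran have "E x + (-1) *\<^sub>C E' x \<in> ?W" using W unfolding star_subalgebra_def by blast
  then have dW: "d \<in> ?W" by (simp add: d_def m1)
  then have sW: "star d \<in> ?W" using W unfolding star_subalgebra_def by blast
  have 1: "\<tau> (star d * F x) = \<tau> (star d * x)" if F: "cond_exp \<pi> \<tau> N F" for F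
  proof -
    have "F (star d * x * 1) = star d * F x * 1"
      using F sW one by (simp only: cond_exp_def)
    moreover have "\<tau> (F (star d * x)) = \<tau> (star d * x)"
      using F by (simp only: cond_exp_def)
    ultimately show ?thesis by simp
  qed
  have "star d * d = star d * E x - star d * E' x" by (simp add: d_def right_diff_distrib)
  moreover have "\<tau> (u - v) = \<tau> u - \<tau> v" for u v
    using tau unfolding faithful_normal_trace_state_def by (metis add_diff_cancel_right' diff_add_cancel)
  ultimately have "\<tau> (star d * d) = 0" using 1[OF E] 1[OF E'] by simp
  then have "d = 0" using tau unfolding faithful_normal_trace_state_def by blast
  then show "E x = E' x" by (simp add: d_def)
qed


section \<open>Freeness with amalgamation\<close>

definition free_amalg :: "('a::cstar_algebra \<Rightarrow> 'a) \<Rightarrow> ('i \<Rightarrow> 'a set) \<Rightarrow> bool" where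
  "free_amalg E Alg \<longleftrightarrow>
     (\<forall>ks xs. xs \<noteq> [] \<and> length ks = length xs \<and> distinct_adj ks \<and>
        (\<forall>j<length xs. xs ! j \<in> Alg (ks ! j) \<and> E (xs ! j) = 0)
        \<longrightarrow> E (prod_list xs) = 0)"

text \<open>\<open>A\<close> and \<open>C\<close> are \<open>B\<close>-free, where \<open>E\<close> is the conditional expectation onto \<open>B\<close>.\<close>
definition B_free ::
  "('a::cstar_algebra \<Rightarrow> 'a) \<Rightarrow> 'a set \<Rightarrow> 'a set \<Rightarrow> 'a set \<Rightarrow> bool" where
  "B_free E B A C \<longleftrightarrow> free_amalg E (\<lambda>i::bool. if i then A \<squnion>\<^sub>a B else B \<squnion>\<^sub>a C)"


section \<open>Holomorphic maps\<close>

text \<open>\<open>F\<close>, with values in \<open>W\<close>, is complex Frechet differentiable at every point of \<open>U\<close>, where \<open>U\<close>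
  is (relatively) open in the complex normed space \<open>V \<times> V'\<close>. The derivative lives on \<open>V \<times> V'\<close>,
  which need not be norm closed, and not on the whole ambient space; for this reason
  \<open>has_derivative\<close> is not used. The norm on pairs is the library's Euclidean one, equivalent to
  the maximum norm.\<close>
definition holomorphic_pair ::
  "'a::cstar_algebra set \<Rightarrow> 'a set \<Rightarrow> 'a set \<Rightarrow> ('a \<times> 'a) set \<Rightarrow> ('a \<times> 'a \<Rightarrow> 'a) \<Rightarrow> bool" where
  "holomorphic_pair V V' W U F \<longleftrightarrow>
     F ` U \<subseteq> W \<and>
     (\<forall>p\<in>U. \<exists>D.
        D ` (V \<times> V') \<subseteq> W \<and>
        (\<forall>h\<in>V \<times> V'. \<forall>k\<in>V \<times> V'. D (h + k) = D h + D k) \<and>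
        (\<forall>c. \<forall>v\<in>V. \<forall>v'\<in>V'. D (c *\<^sub>C v, c *\<^sub>C v') = c *\<^sub>C D (v, v')) \<and>
        (\<exists>K. \<forall>h\<in>V \<times> V'. norm (D h) \<le> K * norm h) \<and>
        ((\<lambda>h. norm (F (p + h) - F p - D h) / norm h) \<longlongrightarrow> 0) (at 0 within V \<times> V'))"

end

theory Submission
  imports Defs "HOL-Complex_Analysis.Conformal_Mappings"
begin

text \<open>The formula \<open>F(a, c) = E\<^sub>A\<^sub>B((a + c)\<^sup>-\<^sup>1)\<^sup>-\<^sup>1 - a\<close> is visibly holomorphic; the point is that its values
  lie in \<open>B\<close>. Let \<open>K\<close> be the closed span of the alternating centred words whose last letter comes
  from \<open>B \<or> C\<close>. Left multiplication by \<open>A \<or> B\<close> preserves \<open>K\<close>, left multiplication by \<open>B \<or> C\<close> maps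
  \<open>K\<close> into \<open>K + B\<close>, and \<open>E\<^sub>B\<close> and \<open>E\<^sub>A\<^sub>B\<close> vanish on \<open>K\<close>. If \<open>a\<close> is replaced by \<open>a + z\<close> with \<open>Im z\<close>
  large, a contraction on \<open>K\<close> solves \<open>(z + a + c) (1 + k) = z + a + \<beta>\<close> with \<open>k \<in> K\<close> and \<open>\<beta> \<in> B\<close>.
  Multiplying by \<open>(z + a + c)\<^sup>-\<^sup>1\<close> and applying \<open>E\<^sub>A\<^sub>B\<close> gives \<open>F(a + z, c) = \<beta>\<close>, and the identity
  theorem in \<open>z\<close> brings this back to \<open>z = 0\<close>.\<close>

section \<open>C*-algebras\<close>

lemma bounded_linear_scaleC: "bounded_linear (\<lambda>x::'a::cstar_algebra. c *\<^sub>C x)"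
proof (rule bounded_linear_intro[where K = "cmod c"])
  show "c *\<^sub>C (r *\<^sub>R x) = r *\<^sub>R (c *\<^sub>C x)" for r and x :: 'a
    by (metis mult.commute scaleC_of_real scaleC_scaleC)
qed (simp_all add: scaleC_add_right norm_scaleC mult.commute)

lemma bounded_linear_scaleC_left: "bounded_linear (\<lambda>c. c *\<^sub>C (x::'a::cstar_algebra))"
proof (rule bounded_linear_intro[where K = "norm x"])
  show "(r *\<^sub>R c) *\<^sub>C x = r *\<^sub>R (c *\<^sub>C x)" for r c
    by (metis scaleC_of_real scaleC_scaleC scaleR_conv_of_real)
qed (simp_all add: scaleC_add_left norm_scaleC)

lemma scaleC_zero_left [simp]: "0 *\<^sub>C (x::'a::cstar_algebra) = 0"
  using scaleC_of_real[of 0 x] by simp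

lemma scaleC_one [simp]: "1 *\<^sub>C (x::'a::cstar_algebra) = x"
  using scaleC_of_real[of 1 x] by simp

lemma scaleC_zero_right [simp]: "c *\<^sub>C (0::'a::cstar_algebra) = 0"
  using bounded_linear.linear[OF bounded_linear_scaleC] by (rule linear_0)

lemma scaleC_minus_left: "(- c) *\<^sub>C (x::'a::cstar_algebra) = - (c *\<^sub>C x)"
  using bounded_linear.linear[OF bounded_linear_scaleC_left] by (rule linear_neg)

lemma scaleC_minus_right: "c *\<^sub>C (- x) = - (c *\<^sub>C (x::'a::cstar_algebra))"
  using bounded_linear.linear[OF bounded_linear_scaleC] by (rule linear_neg)

lemma scaleC_diff_right: "c *\<^sub>C (x - y) = c *\<^sub>C x - c *\<^sub>C (y::'a::cstar_algebra)"
  using bounded_linear.linear[OF bounded_linear_scaleC] by (rule linear_diff)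

lemma scaleC_diff_left: "(c - d) *\<^sub>C (x::'a::cstar_algebra) = c *\<^sub>C x - d *\<^sub>C x"
  using bounded_linear.linear[OF bounded_linear_scaleC_left] by (rule linear_diff)

text \<open>The C*-identity and submultiplicativity give one inequality; applying it to
  \<open>star x\<close> gives the other.\<close>

lemma norm_star: "norm (star x) = norm (x::'a::cstar_algebra)"
proof -
  have le: "norm y \<le> norm (star y)" for y :: 'a
  proof (cases "y = 0")
    case False
    have "(norm y)\<^sup>2 \<le> norm (star y) * norm y"
      using norm_mult_ineq[of "star y" y] by (simp add: cstar_identity)
    with False show ?thesis by (simp add: power2_eq_square)
  qed simp
  from le[of x] le[of "star x"] show ?thesis by (simp add: star_star)
qed

lemma bounded_linear_star: "bounded_linear (star :: 'a::cstar_algebra \<Rightarrow> 'a)"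
proof (rule bounded_linear_intro[where K = 1])
  show "star (r *\<^sub>R x) = r *\<^sub>R star x" for r and x :: 'a
    using star_scaleC[of "complex_of_real r" x] by (simp add: scaleC_of_real)
qed (simp_all add: star_add norm_star)

lemma star_zero [simp]: "star 0 = (0::'a::cstar_algebra)"
  using bounded_linear.linear[OF bounded_linear_star] by (rule linear_0)

lemma star_diff: "star (x - y) = star x - star (y::'a::cstar_algebra)"
  using bounded_linear.linear[OF bounded_linear_star] by (rule linear_diff)

lemma star_scaleR: "star (r *\<^sub>R x) = r *\<^sub>R star (x::'a::cstar_algebra)"
  using bounded_linear.linear[OF bounded_linear_star] by (rule linear_scale)

lemma star_one [simp]: "star 1 = (1::'a::cstar_algebra)"
  using star_mult[of 1 "star (1::'a)"] by (simp add: star_star)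

section \<open>Inverses: perturbation and differentiation\<close>

lemma two_sided_inverse_unique:
  assumes "two_sided_inverse x y" "two_sided_inverse x z"
  shows "y = z"
  using assms unfolding two_sided_inverse_def by (metis mult.assoc mult_1_left mult_1_right)

lemma inv_elem_eq: "two_sided_inverse x y \<Longrightarrow> inv_elem x = y"
  unfolding inv_elem_def by (blast intro: the_equality two_sided_inverse_unique)

lemma two_sided_inverse_inv_elem: "invertible_elem x \<Longrightarrow> two_sided_inverse x (inv_elem x)"
  unfolding invertible_elem_def using inv_elem_eq by metis

lemma two_sided_inverse_mult:
  assumes "two_sided_inverse x x'" "two_sided_inverse y y'"
  shows "two_sided_inverse (x * y) (y' * x')"
  using assms unfolding two_sided_inverse_def by (metis mult.assoc mult_1_left)

text \<open>Fixed points replace the Neumann series: \<open>y = 1 + (1 - x) * y\<close> says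
  \<open>x * y = 1\<close>, the mirrored equation gives a left inverse, and the two
  coincide.\<close>

lemma invertible_near_one:
  fixes x :: "'a::cstar_algebra"
  assumes "norm (1 - x) < 1"
  shows "invertible_elem x"
proof -
  have "\<exists>!y. 1 + (1 - x) * y = y"
    using assms by (intro banach_fix_type[where c = "norm (1 - x)"])
      (auto simp: dist_norm simp flip: right_diff_distrib intro: norm_mult_ineq)
  then obtain y where y: "x * y = 1" by (auto simp: algebra_simps)
  have "dist (1 + u * (1 - x)) (1 + v * (1 - x)) \<le> norm (1 - x) * dist u v" for u v
    using norm_mult_ineq[of "u - v" "1 - x"]
    by (simp add: dist_norm mult.commute flip: left_diff_distrib)
  then have "\<exists>!y. 1 + y * (1 - x) = y"
    using assms by (intro banach_fix_type[where c = "norm (1 - x)"]) auto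
  then obtain z where z: "z * x = 1" by (auto simp: algebra_simps)
  have "z = y" using y z by (metis mult.assoc mult_1_left mult_1_right)
  with y z show ?thesis unfolding invertible_elem_def two_sided_inverse_def by blast
qed

text \<open>\<open>y * x'\<close> is within distance less than 1 of the unit, and
  \<open>x' = x * (y * x')\<close>.\<close>

lemma invertible_perturb:
  fixes x :: "'a::cstar_algebra"
  assumes inv: "two_sided_inverse x y" and near: "norm (x' - x) * norm y < 1"
  shows "invertible_elem x'"
proof -
  have yx: "x * y = 1" "y * x = 1" using inv by (simp_all add: two_sided_inverse_def)
  have "1 - y * x' = - (y * (x' - x))" using yx by (simp add: algebra_simps)
  then have "norm (1 - y * x') \<le> norm (x' - x) * norm y"
    using norm_mult_ineq[of y "x' - x"] by (simp add: mult.commute)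
  with near have "invertible_elem (y * x')" by (intro invertible_near_one) simp
  then obtain z where "two_sided_inverse (y * x') z" by (auto simp: invertible_elem_def)
  then have "two_sided_inverse (x * (y * x')) (z * y)"
    using two_sided_inverse_mult[OF inv] by blast
  moreover have "x * (y * x') = x'" using yx by (simp flip: mult.assoc)
  ultimately show ?thesis by (auto simp: invertible_elem_def)
qed

text \<open>With \<open>z\<close> the inverse of \<open>x + h\<close>, the resolvent identity
  \<open>z - y = - (z * h * y)\<close> used twice leaves the remainder
  \<open>z * h * y * h * y\<close>, which is quadratic in \<open>h\<close>.\<close>

lemma has_derivative_inv_elem:
  fixes x :: "'a::cstar_algebra"
  assumes inv: "two_sided_inverse x y"
  shows "(inv_elem has_derivative (\<lambda>h. - (y * h * y))) (at x)"
proof (rule has_derivativeI_sandwich[where H = "\<lambda>u. 2 * norm y ^ 3 * norm (u - x)"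
      and e = "1 / (2 * norm y)"])
  have yx: "x * y = 1" "y * x = 1" using inv by (simp_all add: two_sided_inverse_def)
  then have y0: "norm y > 0" by force
  then show "0 < 1 / (2 * norm y)" by simp
  show "bounded_linear (\<lambda>h. - (y * h * y))"
    by (simp add: bounded_linear_minus bounded_linear_mult_const bounded_linear_mult_right)
  have "((\<lambda>u. 2 * norm y ^ 3 * norm (u - x)) \<longlongrightarrow> 2 * norm y ^ 3 * norm (x - x)) (at x)"
    by (intro tendsto_intros)
  then show "((\<lambda>u. 2 * norm y ^ 3 * norm (u - x)) \<longlongrightarrow> 0) (at x)" by simp
  \<comment> \<open>This radius forces \<open>norm h * norm y \<le> 1 / 2\<close>, hence
    \<open>norm z \<le> 2 * norm y\<close>; that is the factor 2 in the error bound.\<close>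
  fix u assume u: "u \<noteq> x" "dist u x < 1 / (2 * norm y)"
  define h where "h = u - x"
  have h: "norm h * norm y \<le> 1 / 2" "norm h > 0"
    using u y0 by (simp_all add: h_def dist_norm field_simps)
  then have "invertible_elem u"
    by (intro invertible_perturb[OF inv]) (simp add: h_def)
  then obtain z where z: "two_sided_inverse u z" by (auto simp: invertible_elem_def)
  have zu: "z * u = 1" using z by (simp add: two_sided_inverse_def)
  have zy: "z - y = - (z * h * y)"
  proof -
    have "z * h * y = z * u * y - z * (x * y)"
      by (simp add: h_def algebra_simps)
    then show ?thesis by (simp add: zu yx)
  qed
  have "norm (z * h * y) \<le> norm z * (norm h * norm y)"
    using norm_mult_ineq[of "z * h" y] norm_mult_ineq[of z h]
    by (smt (verit) mult.assoc mult_right_mono norm_ge_zero)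
  also have "\<dots> \<le> norm z * (1 / 2)" using h by (intro mult_left_mono) auto
  finally have "norm (z - y) \<le> norm z / 2" by (simp add: zy)
  then have nz: "norm z \<le> 2 * norm y" using norm_triangle_ineq2[of z y] by simp
  have "z - y - - (y * h * y) = - (z * h * y) - - (y * h * y)" by (simp only: zy)
  also have "\<dots> = - ((z - y) * h * y)" by (simp add: left_diff_distrib)
  also have "\<dots> = z * h * y * h * y" by (simp add: zy)
  finally have "norm (z - y - - (y * h * y)) \<le> norm z * norm h * norm y * norm h * norm y"
    by (smt (verit) mult_right_mono norm_ge_zero norm_mult_ineq)
  also have "\<dots> \<le> (2 * norm y) * norm h * norm y * norm h * norm y"
    using nz by (intro mult_right_mono) auto
  finally have "norm (z - y - - (y * h * y)) / norm h \<le> 2 * norm y ^ 3 * norm h"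
    using h by (simp add: field_simps power3_eq_cube)
  then show "norm (inv_elem u - inv_elem x - - (y * (u - x) * y)) / norm (u - x)
      \<le> 2 * norm y ^ 3 * norm (u - x)"
    using inv_elem_eq[OF z] inv_elem_eq[OF inv] by (simp add: h_def)
qed

section \<open>Positive elements and imaginary parts\<close>

text \<open>The square root is \<open>1 - u\<close> where \<open>u\<close> solves \<open>u = (h + u\<^sup>2) / 2\<close>.\<close>
lemma positive_elem_one_minus:
  fixes h :: "'a::cstar_algebra"
  assumes sa: "star h = h" and small: "norm h \<le> 3 / 4"
  shows "positive_elem (1 - h)"
proof -
  \<comment> \<open>On the ball of radius 1/2 the iteration has Lipschitz constant 1/2, and 3/4 +
    1/4 = 1 is halved back to 1/2, so the ball is preserved. Self-adjointness is built into
    \<open>S\<close> so that the limit inherits it.\<close>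
  define S where "S = {u::'a. star u = u \<and> norm u \<le> 1 / 2}"
  define f where "f u = (1 / 2) *\<^sub>R (h + u * u)" for u
  have "closed S"
    unfolding S_def
    by (intro closed_Collect_conj closed_Collect_eq closed_Collect_le continuous_intros
        linear_continuous_on bounded_linear_star)
  then have "complete S" by (simp add: complete_eq_closed)
  moreover have "0 \<in> S" by (simp add: S_def)
  moreover have "f u \<in> S" if "u \<in> S" for u
  proof -
    have u: "star u = u" "norm u \<le> 1 / 2" using that by (simp_all add: S_def)
    have "norm (u * u) \<le> (1 / 2) * (1 / 2)"
      using norm_mult_ineq[of u u] mult_mono[OF u(2) u(2)] by simp
    then have "norm (h + u * u) \<le> 1"
      using small norm_triangle_ineq[of h "u * u"] by simp
    then show ?thesis
      using sa u by (simp add: S_def f_def star_scaleR star_add star_mult)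
  qed
  moreover have "dist (f u) (f v) \<le> 1 / 2 * dist u v" if "u \<in> S" "v \<in> S" for u v
  proof -
    have uv: "norm u \<le> 1 / 2" "norm v \<le> 1 / 2" using that by (simp_all add: S_def)
    have "u * u - v * v = u * (u - v) + (u - v) * v" by (simp add: algebra_simps)
    also have "norm \<dots> \<le> norm u * norm (u - v) + norm (u - v) * norm v"
      by (smt (verit) norm_mult_ineq norm_triangle_ineq)
    also have "\<dots> \<le> 1 / 2 * norm (u - v) + norm (u - v) * (1 / 2)"
      using uv by (intro add_mono mult_left_mono mult_right_mono) auto
    finally show ?thesis
      by (simp add: f_def dist_norm flip: scaleR_diff_right)
  qed
  ultimately have "\<exists>!u\<in>S. f u = u"
    by (intro Banach_fix[where c = "1 / 2"]) auto
  then obtain u where u: "star u = u" "f u = u" by (auto simp: S_def)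
  have "u + u = h + u * u"
    using arg_cong[OF u(2), of "\<lambda>x. 2 *\<^sub>R x"] by (simp add: f_def scaleR_2)
  then have "1 - h = star (1 - u) * (1 - u)"
    using u(1) by (simp add: star_diff algebra_simps)
  then show ?thesis unfolding positive_elem_def by blast
qed

lemma positive_elem_scaleR:
  assumes "positive_elem x" "0 \<le> r"
  shows "positive_elem (r *\<^sub>R x)"
proof -
  from assms obtain y where "x = star y * y" by (auto simp: positive_elem_def)
  then have "r *\<^sub>R x = star (sqrt r *\<^sub>R y) * (sqrt r *\<^sub>R y)"
    using assms by (simp add: star_scaleR)
  then show ?thesis unfolding positive_elem_def by blast
qed

text \<open>The factor 3/4 comes from the square root iteration; the sharp value would be 1, but the
  loss only affects constants.\<close>

lemma positive_elem_diff:
  fixes x :: "'a::cstar_algebra"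
  assumes "star x = x" "norm x \<le> 3 / 4 * r" "0 < r"
  shows "positive_elem (r *\<^sub>R 1 - x)"
proof -
  have "positive_elem (r *\<^sub>R (1 - (1 / r) *\<^sub>R x))"
    using assms
    by (intro positive_elem_scaleR positive_elem_one_minus)
      (simp_all add: star_scaleR field_simps)
  with \<open>0 < r\<close> show ?thesis by (simp add: scaleR_diff_right)
qed

lemma positive_elem_conj:
  assumes "positive_elem x"
  shows "positive_elem (star z * x * z)"
proof -
  from assms obtain y where "x = star y * y" by (auto simp: positive_elem_def)
  then have "star z * x * z = star (y * z) * (y * z)" by (simp add: star_mult mult.assoc)
  then show ?thesis unfolding positive_elem_def by blast
qed

lemma star_positive_elem: "positive_elem x \<Longrightarrow> star x = x"
  by (auto simp: positive_elem_def star_mult star_star)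

text \<open>\<open>Im_part (\<i> *\<^sub>C x)\<close> is the real part
  \<open>(x + star x) / 2\<close>.\<close>

lemma Re_Im_decomposition:
  fixes x :: "'a::cstar_algebra"
  shows "x = Im_part (\<i> *\<^sub>C x) + \<i> *\<^sub>C Im_part x" and "star (Im_part x) = Im_part x"
proof -
  have "1 / (2 * \<i>) * \<i> = 1 / 2" "\<i> * (1 / (2 * \<i>)) = 1 / 2"
    "cnj (1 / (2 * \<i>)) = - (1 / (2 * \<i>))"
    by simp_all
  note c = this
  have half: "(1 / 2) *\<^sub>C y + (1 / 2) *\<^sub>C y = y" for y :: 'a
    by (simp flip: scaleC_add_left)
  have "Im_part (\<i> *\<^sub>C x) = (1 / 2) *\<^sub>C x + (1 / 2) *\<^sub>C star x"
    unfolding Im_part_def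
    by (simp add: star_scaleC scaleC_minus_left scaleC_add_right scaleC_scaleC)
  moreover have "\<i> *\<^sub>C Im_part x = (1 / 2) *\<^sub>C x - (1 / 2) *\<^sub>C star x"
    unfolding Im_part_def by (simp add: scaleC_diff_right scaleC_scaleC)
  ultimately show "x = Im_part (\<i> *\<^sub>C x) + \<i> *\<^sub>C Im_part x" by (simp add: half)
  show "star (Im_part x) = Im_part x"
    unfolding Im_part_def star_scaleC c(3)
    by (simp add: star_diff star_star scaleC_minus_left scaleC_diff_right)
qed

lemma Im_part_add: "Im_part (x + y) = Im_part x + Im_part (y::'a::cstar_algebra)"
  by (simp add: Im_part_def star_add scaleC_add_right scaleC_diff_right algebra_simps)

lemma Im_part_minus: "Im_part (- x) = - Im_part (x::'a::cstar_algebra)"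
  using Im_part_add[of x "- x"]
  by (simp add: Im_part_def add_eq_0_iff)

lemma Im_part_selfadjoint: "star x = x \<Longrightarrow> Im_part x = 0"
  by (simp add: Im_part_def)

lemma Im_part_scaleC_one: "Im_part (z *\<^sub>C 1) = Im z *\<^sub>R (1::'a::cstar_algebra)"
proof -
  have "Im_part (z *\<^sub>C 1) = ((1 / (2 * \<i>)) * (z - cnj z)) *\<^sub>C (1::'a)"
    by (simp only: Im_part_def star_scaleC star_one scaleC_diff_left flip: scaleC_scaleC)
  also have "(1 / (2 * \<i>)) * (z - cnj z) = complex_of_real (Im z)"
    by (simp add: complex_eq_iff)
  finally show ?thesis by (simp add: scaleC_of_real)
qed

section \<open>Normal representations and conditional expectations\<close>

lemma cinner_scaleH_left: "cinner (c *\<^sub>H u) v = cnj c * cinner u (v::'h::complex_hilbert)"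
  by (metis cinner_commute cinner_scaleH_right complex_cnj_mult)

lemma cinner_self: "cinner u u = complex_of_real ((norm (u::'h::complex_hilbert))\<^sup>2)"
proof -
  have "Im (cinner u u) = 0"
    using arg_cong[OF cinner_commute[of u u], of Im] by simp
  moreover have "Re (cinner u u) = (norm u)\<^sup>2"
    by (simp add: power2_norm_eq_inner inner_eq_Re_cinner)
  ultimately show ?thesis by (simp add: complex_eq_iff)
qed

lemma norm_scaleH: "norm (c *\<^sub>H u) = cmod c * norm (u::'h::complex_hilbert)"
proof -
  have "complex_of_real ((norm (c *\<^sub>H u))\<^sup>2) = complex_of_real ((cmod c * norm u)\<^sup>2)"
    unfolding cinner_self[symmetric] cinner_scaleH_left cinner_scaleH_right
    by (simp add: cinner_self power_mult_distrib mult_ac flip: complex_norm_square)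
  then have "(norm (c *\<^sub>H u))\<^sup>2 = (cmod c * norm u)\<^sup>2" by (simp only: of_real_eq_iff)
  then show ?thesis by (simp add: power2_eq_iff_nonneg)
qed

lemma cmod_cinner_le: "cmod (cinner u v) \<le> norm u * norm (v::'h::complex_hilbert)"
proof (cases "cinner u v = 0")
  case False
  define w where "w = cinner u v"
  \<comment> \<open>A phase of modulus 1 that makes the inner product real and nonnegative, so that
    the real Cauchy-Schwarz inequality applies.\<close>
  define c where "c = cnj w / complex_of_real (cmod w)"
  have w: "w \<noteq> 0" using False by (simp add: w_def)
  have "c * w = complex_of_real (cmod w)"
    using w complex_norm_square[of w] by (simp add: c_def field_simps power2_eq_square)
  then have "cmod w = inner u (c *\<^sub>H v)"
    by (simp add: inner_eq_Re_cinner cinner_scaleH_right w_def)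
  also have "\<dots> \<le> norm u * norm (c *\<^sub>H v)" by (rule norm_cauchy_schwarz)
  also have "norm (c *\<^sub>H v) = norm v"
    using w by (simp add: norm_scaleH c_def norm_divide)
  finally show ?thesis by (simp add: w_def)
qed simp

text \<open>\<open>vec_functional\<close> is a \<open>suminf\<close>, which is meaningful only for a
  summable series.\<close>

lemma summable_cinner:
  fixes \<xi> \<eta> :: "nat \<Rightarrow> 'h::complex_hilbert"
  assumes "l2_seq \<xi>" "l2_seq \<eta>"
  shows "summable (\<lambda>n. cinner (\<xi> n) (blinfun_apply T (\<eta> n)))"
proof (rule summable_comparison_test)
  have "norm (cinner (\<xi> n) (T (\<eta> n))) \<le> norm T * ((norm (\<xi> n))\<^sup>2 + (norm (\<eta> n))\<^sup>2)" for n
  proof -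
    have "norm (cinner (\<xi> n) (T (\<eta> n))) \<le> norm (\<xi> n) * (norm T * norm (\<eta> n))"
      using cmod_cinner_le[of "\<xi> n" "T (\<eta> n)"] norm_blinfun[of T "\<eta> n"]
      by (meson mult_left_mono norm_ge_zero order_trans)
    also have "\<dots> = norm T * (norm (\<xi> n) * norm (\<eta> n))" by simp
    also have "norm (\<xi> n) * norm (\<eta> n) \<le> (norm (\<xi> n))\<^sup>2 + (norm (\<eta> n))\<^sup>2"
      using sum_squares_bound[of "norm (\<xi> n)" "norm (\<eta> n)"]
        mult_nonneg_nonneg[OF norm_ge_zero[of "\<xi> n"] norm_ge_zero[of "\<eta> n"]]
      by linarith
    finally show ?thesis by (simp add: mult_left_mono)
  qed
  then show "\<exists>N. \<forall>n\<ge>N. norm (cinner (\<xi> n) (T (\<eta> n)))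
      \<le> norm T * ((norm (\<xi> n))\<^sup>2 + (norm (\<eta> n))\<^sup>2)" by blast
  show "summable (\<lambda>n. norm T * ((norm (\<xi> n))\<^sup>2 + (norm (\<eta> n))\<^sup>2))"
    using assms unfolding l2_seq_def by (intro summable_mult summable_add)
qed

lemma l2_seq_apply:
  fixes \<xi> :: "nat \<Rightarrow> 'h::complex_hilbert"
  assumes "l2_seq \<xi>"
  shows "l2_seq (\<lambda>n. blinfun_apply T (\<xi> n))"
  unfolding l2_seq_def
proof (rule summable_comparison_test)
  have "norm ((norm (T (\<xi> n)))\<^sup>2) \<le> (norm T)\<^sup>2 * (norm (\<xi> n))\<^sup>2" for n
    using power_mono[OF norm_blinfun[of T "\<xi> n"], of 2] by (simp add: power_mult_distrib)
  then show "\<exists>N. \<forall>n\<ge>N. norm ((norm (T (\<xi> n)))\<^sup>2) \<le> (norm T)\<^sup>2 * (norm (\<xi> n))\<^sup>2" by blast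
  show "summable (\<lambda>n. (norm T)\<^sup>2 * (norm (\<xi> n))\<^sup>2)"
    using assms unfolding l2_seq_def by (intro summable_mult)
qed

lemma closedin_vec_functional_zero:
  fixes \<xi> \<eta> :: "nat \<Rightarrow> 'h::complex_hilbert"
  assumes "l2_seq \<xi>" "l2_seq \<eta>"
  shows "closedin ultraweak {T. vec_functional \<xi> \<eta> T = 0}"
proof -
  let ?S = "{vec_functional \<xi> \<eta> -` U |(\<xi>::nat \<Rightarrow> 'h) \<eta> U. l2_seq \<xi> \<and> l2_seq \<eta> \<and> open U}"
  \<comment> \<open>Taking \<open>U = UNIV\<close> shows that the generating sets cover all
    operators.\<close>
  have "vec_functional \<xi> \<eta> -` UNIV \<in> ?S" using assms open_UNIV by blast
  then have top: "topspace ultraweak = (UNIV :: ('h \<Rightarrow>\<^sub>L 'h) set)"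
    unfolding ultraweak_def by auto
  have "vec_functional \<xi> \<eta> -` (- {0}) \<in> ?S" using assms open_Compl[OF closed_singleton] by blast
  then have "openin ultraweak (vec_functional \<xi> \<eta> -` (- {0}))"
    unfolding ultraweak_def by (rule topology_generated_by_Basis)
  moreover have "vec_functional \<xi> \<eta> -` (- {0}) = UNIV - {T. vec_functional \<xi> \<eta> T = 0}" by auto
  ultimately show ?thesis by (simp add: closedin_def top)
qed

section \<open>Quadratic forms and normal functionals in a faithful representation\<close>

locale wstar_rep =
  fixes \<pi> :: "'a::cstar_algebra \<Rightarrow> 'h::complex_hilbert \<Rightarrow>\<^sub>L 'h"
  assumes wstar: "wstar_algebra \<pi>"
begin

lemma rep_add: "\<pi> (x + y) = \<pi> x + \<pi> y"
  and rep_scaleC: "\<pi> (c *\<^sub>C x) v = c *\<^sub>H \<pi> x v"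
  and rep_mult: "\<pi> (x * y) v = \<pi> x (\<pi> y v)"
  and rep_one: "\<pi> 1 v = v"
  and rep_star: "cinner (\<pi> (star x) u) v = cinner u (\<pi> x v)"
  and norm_rep: "norm (\<pi> x) = norm x"
  and closed_range_rep: "closedin ultraweak (range \<pi>)"
  using wstar unfolding wstar_algebra_def by simp_all

lemma norm_rep_apply_le: "norm (\<pi> x v) \<le> norm x * norm v"
  using norm_blinfun[of "\<pi> x" v] by (simp add: norm_rep)

lemma norm_le_of_rep:
  assumes "0 \<le> K" "\<And>v. norm (\<pi> x v) \<le> K * norm v"
  shows "norm x \<le> K"
  using norm_blinfun_bound[OF assms] by (simp add: norm_rep)

lemma bounded_linear_form: "bounded_linear (\<lambda>x. cinner u (\<pi> x v))"
proof (rule bounded_linear_intro[where K = "norm u * norm v"])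
  show "cinner u (\<pi> (x + y) v) = cinner u (\<pi> x v) + cinner u (\<pi> y v)" for x y
    by (simp add: rep_add cinner_add_right blinfun.add_left)
  show "cinner u (\<pi> (r *\<^sub>R x) v) = r *\<^sub>R cinner u (\<pi> x v)" for r x
    using rep_scaleC[of "complex_of_real r" x v]
    by (simp add: scaleC_of_real cinner_scaleH_right scaleR_conv_of_real)
  show "norm (cinner u (\<pi> x v)) \<le> norm x * (norm u * norm v)" for x
    using cmod_cinner_le[of u "\<pi> x v"] mult_left_mono[OF norm_rep_apply_le[of x v], of "norm u"]
    by (simp add: mult_ac)
qed

lemma form_scaleC: "cinner u (\<pi> (c *\<^sub>C x) v) = c * cinner u (\<pi> x v)"
  by (simp add: rep_scaleC cinner_scaleH_right)

text \<open>Matrix coefficients separate elements; this lets the scalar identity theorem decide an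
  operator-valued identity.\<close>

lemma eq_zero_of_form:
  assumes "\<And>u v. cinner u (\<pi> x v) = 0"
  shows "x = 0"
proof -
  have "\<pi> x v = 0" for v
    using assms[of "\<pi> x v" v] by (simp add: cinner_self)
  then have "norm x \<le> 0" by (intro norm_le_of_rep) simp_all
  then show ?thesis by simp
qed

text \<open>Lower bounds are carried by these forms: they add trivially, whereas a sum of elements
  \<open>star y * y\<close> being again of this shape is a nontrivial fact.\<close>

definition qf :: "'h \<Rightarrow> 'a \<Rightarrow> real"
  where "qf v x = Re (cinner v (\<pi> x v))"

lemma bounded_linear_qf: "bounded_linear (qf v)"
  unfolding qf_def by (intro bounded_linear_compose[OF bounded_linear_Re] bounded_linear_form)

lemmas qf_add = linear_add[OF bounded_linear.linear[OF bounded_linear_qf]]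
  and qf_diff = linear_diff[OF bounded_linear.linear[OF bounded_linear_qf]]
  and qf_scaleR = linear_scale[OF bounded_linear.linear[OF bounded_linear_qf]]

lemma qf_one: "qf v 1 = (norm v)\<^sup>2"
  by (simp add: qf_def rep_one cinner_self)

lemma qf_star_mult: "qf v (star x * x) = (norm (\<pi> x v))\<^sup>2"
  using arg_cong[OF rep_star[of "star x" v "\<pi> x v"], of Re]
  by (simp add: qf_def rep_mult star_star cinner_self flip: of_real_power)

lemma qf_positive: "positive_elem x \<Longrightarrow> 0 \<le> qf v x"
  by (auto simp: positive_elem_def qf_star_mult)

lemma selfadjoint_form_real:
  assumes "star x = x"
  shows "Im (cinner v (\<pi> x v)) = 0"
proof -
  have "cnj (cinner v (\<pi> x v)) = cinner (\<pi> x v) v" by (rule cinner_commute[symmetric])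
  also have "\<dots> = cinner v (\<pi> x v)" using rep_star[of x v v] assms by simp
  finally show ?thesis by (simp add: complex_eq_iff)
qed

lemma qf_Im_part: "qf v (Im_part x) = Im (cinner v (\<pi> x v))"
proof -
  have "cinner v (\<pi> x v) = cinner v (\<pi> (Im_part (\<i> *\<^sub>C x)) v) + \<i> * cinner v (\<pi> (Im_part x) v)"
    by (subst Re_Im_decomposition(1)[of x])
      (simp add: rep_add blinfun.add_left cinner_add_right form_scaleC)
  then show ?thesis
    by (simp add: qf_def selfadjoint_form_real Re_Im_decomposition(2))
qed

text \<open>For \<open>w = \<pi> y v\<close> one has \<open>\<epsilon> * (norm w)\<^sup>2 \<le> Im
  (cinner w v) \<le> norm w * norm v\<close>, because \<open>\<pi> x w = v\<close>.\<close>

lemma norm_inverse_le: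
  assumes "0 < \<epsilon>" and low: "\<And>v. \<epsilon> * (norm v)\<^sup>2 \<le> qf v (Im_part x)"
    and inv: "two_sided_inverse x y"
  shows "norm y \<le> 1 / \<epsilon>"
proof (rule norm_le_of_rep)
  fix v
  have "\<pi> x (\<pi> y v) = v"
    using inv by (simp add: two_sided_inverse_def rep_one flip: rep_mult)
  then have "\<epsilon> * (norm (\<pi> y v))\<^sup>2 \<le> Im (cinner (\<pi> y v) v)"
    using low[of "\<pi> y v"] by (simp add: qf_Im_part)
  also have "\<dots> \<le> norm (\<pi> y v) * norm v"
    using cmod_cinner_le[of "\<pi> y v" v] abs_Im_le_cmod[of "cinner (\<pi> y v) v"] by linarith
  finally have "norm (\<pi> y v) * (\<epsilon> * norm (\<pi> y v)) \<le> norm (\<pi> y v) * norm v"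
    by (simp add: power2_eq_square mult_ac)
  then have "\<epsilon> * norm (\<pi> y v) \<le> norm v \<or> norm (\<pi> y v) = 0"
    by (metis mult_le_cancel_left_pos norm_ge_zero order_le_less)
  with \<open>0 < \<epsilon>\<close> show "norm (\<pi> y v) \<le> 1 / \<epsilon> * norm v"
    by (auto simp: field_simps)
qed (use assms in simp)

text \<open>Move from \<open>x + s\<i>\<close> with \<open>s\<close> large, which is invertible, down to \<open>s = 0\<close>; the inverses stay
  bounded by \<open>1 / \<epsilon>\<close>, so that steps of length \<open>\<epsilon> / 2\<close> are possible.\<close>
lemma invertible_of_Im_bounded_below:
  assumes "0 < \<epsilon>" and low: "\<And>v. \<epsilon> * (norm v)\<^sup>2 \<le> qf v (Im_part x)"
  shows "invertible_elem x"
proof -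
  define T where "T s = x + (complex_of_real s * \<i>) *\<^sub>C 1" for s
  have T_diff: "norm (T s - T s') = \<bar>s - s'\<bar>" for s s'
  proof -
    have "T s - T s' = (complex_of_real (s - s') * \<i>) *\<^sub>C 1"
      by (simp add: T_def scaleC_diff_left left_diff_distrib)
    then show ?thesis by (simp add: norm_scaleC norm_mult del: of_real_diff)
  qed
  have T_low: "\<epsilon> * (norm v)\<^sup>2 \<le> qf v (Im_part (T s))" if "0 \<le> s" for s v
    using low[of v] that
    by (simp add: T_def Im_part_add Im_part_scaleC_one qf_add qf_scaleR qf_one add_increasing2)
  define s0 where "s0 = norm x + 1"
  have step: "invertible_elem (T s)" if "0 \<le> s" "s0 - real n * (\<epsilon> / 2) \<le> s" for s n
    using that
  proof (induction n arbitrary: s)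
    case 0
    \<comment> \<open>Start of the descent: for \<open>s > norm x\<close> the scalar part dominates,
      and \<open>T s\<close> is a small perturbation of it.\<close>
    then have s: "norm x < s" "0 < s" using norm_ge_zero[of x] unfolding s0_def by linarith+
    let ?z = "complex_of_real s * \<i>"
    have "two_sided_inverse (?z *\<^sub>C (1::'a)) ((1 / ?z) *\<^sub>C 1)"
      using s by (simp add: two_sided_inverse_def mult_scaleC_left scaleC_scaleC)
    moreover have "norm (T s - ?z *\<^sub>C 1) * norm ((1 / ?z) *\<^sub>C (1::'a)) < 1"
      using s by (simp add: T_def norm_scaleC norm_divide norm_mult)
    ultimately show ?case by (rule invertible_perturb)
  next
    case (Suc n)
    have "s0 - real n * (\<epsilon> / 2) \<le> s + \<epsilon> / 2"
      using Suc.prems by (simp add: field_simps)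
    then have "invertible_elem (T (s + \<epsilon> / 2))"
      using Suc.prems \<open>0 < \<epsilon>\<close> by (intro Suc.IH) auto
    then obtain y where y: "two_sided_inverse (T (s + \<epsilon> / 2)) y"
      by (auto simp: invertible_elem_def)
    have "norm y \<le> 1 / \<epsilon>"
      using Suc.prems \<open>0 < \<epsilon>\<close> by (intro norm_inverse_le[OF _ T_low y]) auto
    then have "norm (T s - T (s + \<epsilon> / 2)) * norm y \<le> (\<epsilon> / 2) * (1 / \<epsilon>)"
      using \<open>0 < \<epsilon>\<close> unfolding T_diff by (intro mult_mono) auto
    then show ?case using \<open>0 < \<epsilon>\<close> by (intro invertible_perturb[OF y]) auto
  qed
  obtain n where "s0 / (\<epsilon> / 2) \<le> real n" using real_arch_simple by blast
  then have "invertible_elem (T 0)"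
    using \<open>0 < \<epsilon>\<close> by (intro step[of 0 n]) (simp_all add: field_simps)
  then show ?thesis by (simp add: T_def)
qed

lemma vec_functional_rep_add:
  assumes "l2_seq \<xi>" "l2_seq \<eta>"
  shows "vec_functional \<xi> \<eta> (\<pi> (x + y)) = vec_functional \<xi> \<eta> (\<pi> x) + vec_functional \<xi> \<eta> (\<pi> y)"
  unfolding vec_functional_def
  using suminf_add[OF summable_cinner[OF assms, of "\<pi> x"] summable_cinner[OF assms, of "\<pi> y"]]
  by (simp add: rep_add blinfun.add_left cinner_add_right)

lemma vec_functional_rep_scaleC:
  assumes "l2_seq \<xi>" "l2_seq \<eta>"
  shows "vec_functional \<xi> \<eta> (\<pi> (c *\<^sub>C x)) = c * vec_functional \<xi> \<eta> (\<pi> x)"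
  unfolding vec_functional_def form_scaleC rep_scaleC cinner_scaleH_right
  by (rule suminf_mult[OF summable_cinner[OF assms]])

lemma vec_functional_rep_star:
  assumes "l2_seq \<xi>" "l2_seq \<eta>"
  shows "vec_functional \<xi> \<eta> (\<pi> (star x)) = cnj (vec_functional \<eta> \<xi> (\<pi> x))"
proof -
  have "(\<lambda>n. cinner (\<eta> n) (\<pi> x (\<xi> n))) sums vec_functional \<eta> \<xi> (\<pi> x)"
    unfolding vec_functional_def by (rule summable_sums[OF summable_cinner[OF assms(2,1)]])
  then have "(\<lambda>n. cnj (cinner (\<eta> n) (\<pi> x (\<xi> n)))) sums cnj (vec_functional \<eta> \<xi> (\<pi> x))"
    by (simp add: sums_cnj)
  moreover have "cnj (cinner (\<eta> n) (\<pi> x (\<xi> n))) = cinner (\<xi> n) (\<pi> (star x) (\<eta> n))" for n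
    by (metis cinner_commute rep_star)
  ultimately show ?thesis unfolding vec_functional_def by (simp add: sums_iff)
qed

text \<open>Multiplying the argument on either side only changes one of the vector sequences, so the
  functional remains normal.\<close>

lemma vec_functional_rep_mult:
  "vec_functional \<xi> \<eta> (\<pi> (x * y)) = vec_functional \<xi> (\<lambda>n. \<pi> y (\<eta> n)) (\<pi> x)"
  "vec_functional \<xi> \<eta> (\<pi> (x * y)) = vec_functional (\<lambda>n. \<pi> (star x) (\<xi> n)) \<eta> (\<pi> y)"
  by (simp_all add: vec_functional_def rep_mult rep_star)

text \<open>The elements at which every normal functional annihilating \<open>N\<close> vanishes form a
  W*-subalgebra, which therefore contains the generated one.\<close>
lemma normal_zero_on_wstar_generated:
  assumes N: "star_subalgebra N" and l2: "l2_seq \<xi>" "l2_seq \<eta>"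
    and zero: "\<And>n. n \<in> N \<Longrightarrow> vec_functional \<xi> \<eta> (\<pi> n) = 0"
    and m: "m \<in> wstar_generated \<pi> N"
  shows "vec_functional \<xi> \<eta> (\<pi> m) = 0"
proof -
  define P where
    "P = {(\<xi>, \<eta>). l2_seq \<xi> \<and> l2_seq \<eta> \<and> (\<forall>n\<in>N. vec_functional \<xi> \<eta> (\<pi> n) = 0)}"
  define X where "X = {x. \<forall>(\<xi>, \<eta>) \<in> P. vec_functional \<xi> \<eta> (\<pi> x) = 0}"
  have NX: "N \<subseteq> X" by (auto simp: P_def X_def)
  \<comment> \<open>First \<open>N * X \<subseteq> X\<close>: for \<open>n\<close> in
    \<open>N\<close> the functional \<open>\<lambda>x. \<phi> (n * x)\<close> annihilates
    \<open>N\<close> whenever \<open>\<phi>\<close> does.\<close>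
  have mult: "n * x \<in> X" if "n \<in> N" "x \<in> X" for n x
  proof -
    have "(\<lambda>k. \<pi> (star n) (\<xi> k), \<eta>) \<in> P" if "(\<xi>, \<eta>) \<in> P" for \<xi> \<eta>
      using that \<open>n \<in> N\<close> N unfolding P_def star_subalgebra_def
      by (auto simp: l2_seq_apply simp flip: vec_functional_rep_mult(2))
    with \<open>x \<in> X\<close> show ?thesis by (fastforce simp: X_def vec_functional_rep_mult(2))
  qed
  \<comment> \<open>Then \<open>X * X \<subseteq> X\<close>: by the previous fact
    \<open>\<lambda>x. \<phi> (x * y)\<close> annihilates \<open>N\<close> for \<open>y\<close> in
    \<open>X\<close>, hence also \<open>X\<close>.\<close>
  have "x * y \<in> X" if "x \<in> X" "y \<in> X" for x y
  proof -
    have "(\<xi>, \<lambda>k. \<pi> y (\<eta> k)) \<in> P" if "(\<xi>, \<eta>) \<in> P" for \<xi> \<eta>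
    proof -
      have "vec_functional \<xi> \<eta> (\<pi> (n * y)) = 0" if "n \<in> N" for n
        using mult[OF that \<open>y \<in> X\<close>] \<open>(\<xi>, \<eta>) \<in> P\<close> by (auto simp: X_def)
      with that show ?thesis by (auto simp: P_def l2_seq_apply vec_functional_rep_mult(1))
    qed
    with \<open>x \<in> X\<close> show ?thesis by (fastforce simp: X_def vec_functional_rep_mult(1))
  qed
  moreover have "star x \<in> X" if "x \<in> X" for x
  proof -
    have "vec_functional \<xi> \<eta> (\<pi> (star x)) = 0" if \<xi>: "(\<xi>, \<eta>) \<in> P" for \<xi> \<eta>
    proof -
      have l2: "l2_seq \<xi>" "l2_seq \<eta>" using \<xi> by (auto simp: P_def)
      have "vec_functional \<eta> \<xi> (\<pi> n) = 0" if "n \<in> N" for n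
      proof -
        have "star n \<in> N" using N that by (simp add: star_subalgebra_def)
        then have "vec_functional \<xi> \<eta> (\<pi> (star n)) = 0" using \<xi> by (auto simp: P_def)
        then show ?thesis by (simp add: vec_functional_rep_star l2)
      qed
      then have "(\<eta>, \<xi>) \<in> P" using l2 by (simp add: P_def)
      with \<open>x \<in> X\<close> show ?thesis by (auto simp: X_def vec_functional_rep_star l2)
    qed
    then show ?thesis by (auto simp: X_def)
  qed
  moreover have "1 \<in> X" using N NX by (auto simp: star_subalgebra_def)
  moreover have "x + y \<in> X" if "x \<in> X" "y \<in> X" for x y
    using that by (auto simp: X_def P_def vec_functional_rep_add)
  moreover have "c *\<^sub>C x \<in> X" if "x \<in> X" for c x
    using that by (auto simp: X_def P_def vec_functional_rep_scaleC)
  ultimately have "star_subalgebra X" by (simp add: star_subalgebra_def)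
  moreover have "closedin ultraweak (\<pi> ` X)"
  proof -
    \<comment> \<open>The kernels consist of arbitrary operators, so \<open>range \<pi>\<close> has
      to join the intersection.\<close>
    have "\<pi> ` X = \<Inter> (insert (range \<pi>) ((\<lambda>(\<xi>, \<eta>). {T. vec_functional \<xi> \<eta> T = 0}) ` P))"
      by (fastforce simp: X_def)
    moreover have "closedin ultraweak S"
      if "S \<in> insert (range \<pi>) ((\<lambda>(\<xi>, \<eta>). {T. vec_functional \<xi> \<eta> T = 0}) ` P)" for S
      using that closed_range_rep by (auto simp: P_def intro: closedin_vec_functional_zero)
    ultimately show ?thesis by (metis closedin_Inter empty_not_insert)
  qed
  ultimately have "wstar_generated \<pi> N \<subseteq> X"
    unfolding wstar_generated_def
    by (intro hull_minimal NX) (simp add: wstar_subalgebra_def)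
  moreover have "(\<xi>, \<eta>) \<in> P" using l2 zero by (simp add: P_def)
  ultimately show ?thesis using m by (auto simp: X_def)
qed

end

section \<open>The trace-preserving conditional expectation\<close>

locale conditional_expectation = wstar_rep \<pi>
  for \<pi> :: "'a::cstar_algebra \<Rightarrow> 'h::complex_hilbert \<Rightarrow>\<^sub>L 'h" +
  fixes \<tau> :: "'a \<Rightarrow> complex" and N :: "'a set" and E :: "'a \<Rightarrow> 'a"
  assumes trace: "faithful_normal_trace_state \<pi> \<tau>"
    and cond_exp: "cond_exp \<pi> \<tau> N E"
begin

abbreviation "W \<equiv> wstar_generated \<pi> N"

lemma E_in: "E x \<in> W"
  and E_fix: "y \<in> W \<Longrightarrow> E y = y"
  and E_add: "E (x + y) = E x + E y"
  and E_scaleC: "E (c *\<^sub>C x) = c *\<^sub>C E x"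
  and E_positive: "positive_elem x \<Longrightarrow> positive_elem (E x)"
  and E_bimodule: "y \<in> W \<Longrightarrow> z \<in> W \<Longrightarrow> E (y * x * z) = y * E x * z"
  and trace_E: "\<tau> (E x) = \<tau> x"
  using cond_exp unfolding cond_exp_def by blast+

lemma W_one: "1 \<in> W"
  and W_star: "x \<in> W \<Longrightarrow> star x \<in> W"
  using star_subalgebra_wstar_generated[of \<pi> N] by (simp_all add: star_subalgebra_def)

lemma W_superset: "N \<subseteq> W"
  unfolding wstar_generated_def by (rule hull_subset)

lemma E_left: "y \<in> W \<Longrightarrow> E (y * x) = y * E x"
  and E_right: "z \<in> W \<Longrightarrow> E (x * z) = E x * z"
  using E_bimodule[OF _ W_one] E_bimodule[OF W_one] by (metis mult_1_right, metis mult_1_left)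

lemma linear_E: "linear E"
  by (rule linearI) (simp_all only: E_add E_scaleC flip: scaleC_of_real)

lemmas E_diff = linear_diff[OF linear_E]
  and E_scaleR = linear_scale[OF linear_E]
  and E_neg = linear_neg[OF linear_E]

lemma E_one: "E 1 = 1"
  by (rule E_fix[OF W_one])

lemma E_idem: "E (E x) = E x"
  by (rule E_fix[OF E_in])

text \<open>Positivity suffices: for self-adjoint \<open>y\<close> and large \<open>r\<close> the
  element \<open>r *\<^sub>R 1 - y\<close> is positive, so its image is self-adjoint; the general
  case splits into real and imaginary parts.\<close>

lemma star_E: "star (E x) = E (star x)"
proof -
  have sa: "star (E y) = E y" if "star y = y" for y
  proof -
    \<comment> \<open>The summand 1 keeps \<open>r\<close> positive when
      \<open>y = 0\<close>.\<close>
    define r where "r = 4 / 3 * norm y + 1"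
    have "positive_elem (r *\<^sub>R 1 - y)"
      using that by (intro positive_elem_diff) (simp_all add: r_def add_nonneg_pos)
    then have "star (E (r *\<^sub>R 1 - y)) = E (r *\<^sub>R 1 - y)"
      by (intro star_positive_elem E_positive)
    then show ?thesis by (simp add: E_diff E_scaleR E_one star_diff star_scaleR)
  qed
  show ?thesis
    by (subst (1 2) Re_Im_decomposition(1)[of x])
      (simp add: E_add E_scaleC star_add star_scaleC sa Re_Im_decomposition(2))
qed

lemma E_Im_part: "E (Im_part x) = Im_part (E x)"
  by (simp add: Im_part_def E_scaleC E_diff star_E)

text \<open>Kadison's inequality bounds \<open>star (E x) * E x\<close> by
  \<open>E (star x * x)\<close>, and the latter is at most \<open>4 / 3 * (norm x)\<^sup>2\<close>.
  The constant 2 is a crude bound for the square root of 4/3.\<close>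

lemma norm_E_le: "norm (E x) \<le> 2 * norm x"
proof (cases "x = 0")
  case False
  define p where "p = x - E x"
  define r where "r = 4 / 3 * (norm x)\<^sup>2"
  have "E (star p * p) = E (star x * x) - E (star x * E x) - E (star (E x) * x) + E (star (E x) * E x)"
    by (simp add: p_def star_diff algebra_simps E_diff E_add)
  also have "\<dots> = E (star x * x) - star (E x) * E x"
    by (simp add: E_left E_right E_in W_star star_E E_idem)
  finally have kadison: "positive_elem (E (star x * x) - star (E x) * E x)"
    using E_positive[of "star p * p"] by (auto simp: positive_elem_def)
  have "positive_elem (r *\<^sub>R 1 - star x * x)"
    using False
    by (intro positive_elem_diff) (simp_all add: r_def star_mult star_star cstar_identity)
  then have upper: "positive_elem (r *\<^sub>R 1 - E (star x * x))"
    using E_positive[of "r *\<^sub>R 1 - star x * x"] by (simp add: E_diff E_scaleR E_one)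
  show ?thesis
  proof (rule norm_le_of_rep)
    fix v
    have "(norm (\<pi> (E x) v))\<^sup>2 \<le> r * (norm v)\<^sup>2"
      using qf_positive[OF kadison, of v] qf_positive[OF upper, of v]
      by (simp add: qf_diff qf_star_mult qf_scaleR qf_one)
    also have "\<dots> \<le> (2 * norm x * norm v)\<^sup>2"
      by (simp add: r_def power_mult_distrib mult_right_mono)
    finally show "norm (\<pi> (E x) v) \<le> 2 * norm x * norm v"
      by (rule power2_le_imp_le) simp
  qed simp
qed (simp add: linear_0[OF linear_E])

lemma bounded_linear_E: "bounded_linear E"
  using norm_E_le
  by (intro bounded_linear_intro[where K = 2]) (simp_all only: E_add E_scaleR mult.commute[of _ 2])

text \<open>For \<open>y = x\<^sup>-\<^sup>1\<close>, conjugating \<open>Im x \<ge> \<epsilon>\<close> and \<open>x\<^sup>* x \<le> r\<close> by \<open>y\<close> gives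
  \<open>- Im y \<ge> \<epsilon> y\<^sup>* y \<ge> \<epsilon> / r\<close>, and positivity passes this on to \<open>E y\<close>.\<close>
lemma invertible_E_inverse:
  assumes "0 < \<epsilon>" and "positive_elem p" "positive_elem q" and x: "Im_part x = \<epsilon> *\<^sub>R 1 + p + q"
    and inv: "two_sided_inverse x y"
  shows "invertible_elem (E y)"
proof -
  have xy: "x * y = 1" and yx: "star y * star x = 1"
    using inv star_mult[of x y] by (simp_all add: two_sided_inverse_def)
  then have "x \<noteq> 0" by auto
  define r where "r = 4 / 3 * (norm x)\<^sup>2"
  have r: "r > 0" using \<open>x \<noteq> 0\<close> by (simp add: r_def)
  have "positive_elem (r *\<^sub>R 1 - star x * x)"
    using r by (intro positive_elem_diff) (simp_all add: r_def star_mult star_star cstar_identity)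
  then have "positive_elem (star y * (r *\<^sub>R 1 - star x * x) * y)" by (rule positive_elem_conj)
  moreover have "star y * (r *\<^sub>R 1 - star x * x) * y = r *\<^sub>R (star y * y) - (star y * star x) * (x * y)"
    by (simp add: algebra_simps)
  ultimately have s: "positive_elem (r *\<^sub>R (star y * y) - 1)" by (simp add: xy yx)
  have "star y * Im_part x * y = (1 / (2 * \<i>)) *\<^sub>C (star y * (x * y) - (star y * star x) * y)"
    by (simp add: Im_part_def mult_scaleC_left mult_scaleC_right algebra_simps)
  also have "\<dots> = - Im_part y"
    by (simp add: xy yx Im_part_def scaleC_diff_right)
  \<comment> \<open>The four summands stay separate, each being a scalar or a single positive
    element, so that \<open>E\<close> and the forms can be applied term by term.\<close>
  finally have "- Im_part y = star y * (\<epsilon> *\<^sub>R 1 + p + q) * y" using x by simp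
  also have "\<dots> = (\<epsilon> / r) *\<^sub>R 1 + (\<epsilon> / r) *\<^sub>R (r *\<^sub>R (star y * y) - 1)
      + star y * p * y + star y * q * y"
    using r by (simp add: algebra_simps)
  finally have Im_y: "- Im_part y = \<dots>" .
  have "\<epsilon> / r * (norm v)\<^sup>2 \<le> qf v (Im_part (- E y))" for v
  proof -
    have "Im_part (- E y) = E (- Im_part y)"
      by (simp add: Im_part_minus E_Im_part E_neg)
    then have "qf v (Im_part (- E y)) = \<epsilon> / r * (norm v)\<^sup>2
        + \<epsilon> / r * qf v (E (r *\<^sub>R (star y * y) - 1))
        + qf v (E (star y * p * y)) + qf v (E (star y * q * y))"
      by (simp only: Im_y E_add E_scaleR E_one qf_add qf_scaleR qf_one real_scaleR_def)
    moreover have "0 \<le> \<epsilon> / r * qf v (E (r *\<^sub>R (star y * y) - 1))"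
      using \<open>0 < \<epsilon>\<close> r s by (intro mult_nonneg_nonneg qf_positive E_positive) auto
    moreover have "0 \<le> qf v (E (star y * p * y))" "0 \<le> qf v (E (star y * q * y))"
      using assms(2,3) by (simp_all add: qf_positive E_positive positive_elem_conj)
    ultimately show ?thesis by linarith
  qed
  then have "invertible_elem (- E y)"
    using \<open>0 < \<epsilon>\<close> r by (intro invertible_of_Im_bounded_below[of "\<epsilon> / r"]) auto
  then obtain g where "two_sided_inverse (- E y) g" by (auto simp: invertible_elem_def)
  then have "two_sided_inverse (E y) (- g)" by (simp add: two_sided_inverse_def)
  then show ?thesis by (auto simp: invertible_elem_def)
qed

text \<open>Normality of \<open>\<tau>\<close> extends the vanishing from \<open>N\<close> to the
  generated W*-algebra; at \<open>m = star (E k)\<close> it yields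
  \<open>\<tau> (star (E k) * E k) = 0\<close>, and faithfulness concludes.\<close>

lemma E_eq_zero:
  assumes N: "star_subalgebra N" and k: "\<And>m. m \<in> N \<Longrightarrow> \<tau> (m * k) = 0"
  shows "E k = 0"
proof -
  have "normal_functional \<pi> \<tau>" using trace by (simp add: faithful_normal_trace_state_def)
  then obtain \<xi> \<eta> where l2: "l2_seq \<xi>" "l2_seq \<eta>"
    and \<tau>: "\<And>x. \<tau> x = vec_functional \<xi> \<eta> (\<pi> x)"
    by (auto simp: normal_functional_def)
  have "vec_functional \<xi> (\<lambda>n. \<pi> k (\<eta> n)) (\<pi> m) = 0" if "m \<in> N" for m
    using k[OF that] by (simp only: \<tau> vec_functional_rep_mult(1))
  then have "vec_functional \<xi> (\<lambda>n. \<pi> k (\<eta> n)) (\<pi> (star (E k))) = 0"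
    by (rule normal_zero_on_wstar_generated[OF N l2(1) l2_seq_apply[OF l2(2)] _ W_star[OF E_in]])
  then have "\<tau> (star (E k) * k) = 0" by (simp only: \<tau> vec_functional_rep_mult(1))
  then have "\<tau> (star (E k) * E k) = 0"
    using trace_E[of "star (E k) * k"] E_left[OF W_star[OF E_in]] by simp
  then show ?thesis using trace by (simp add: faithful_normal_trace_state_def)
qed

end

section \<open>Freeness and subordination\<close>

lemma subalgebra_alg_join: "subalgebra (A \<squnion>\<^sub>a B)"
  unfolding alg_join_def hull_def subalgebra_def by blast

lemma alg_join_superset: "A \<subseteq> A \<squnion>\<^sub>a B" "B \<subseteq> A \<squnion>\<^sub>a B"
  unfolding alg_join_def using hull_subset[of "A \<union> B" subalgebra] by simp_all

text \<open>The elements whose adjoint lies in the join form a subalgebra containing the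
  generators.\<close>

lemma star_subalgebra_alg_join:
  assumes "star_subalgebra A" "star_subalgebra B"
  shows "star_subalgebra (A \<squnion>\<^sub>a B)"
proof -
  have sub: "subalgebra (A \<squnion>\<^sub>a B)" by (rule subalgebra_alg_join)
  have "subalgebra {x. star x \<in> A \<squnion>\<^sub>a B}"
    using sub by (simp add: subalgebra_def star_add star_mult star_scaleC)
  moreover have "A \<union> B \<subseteq> {x. star x \<in> A \<squnion>\<^sub>a B}"
    using assms alg_join_superset[where A = A and B = B] unfolding star_subalgebra_def by blast
  ultimately have "A \<squnion>\<^sub>a B \<subseteq> {x. star x \<in> A \<squnion>\<^sub>a B}"
    unfolding alg_join_def[of A B] by (intro hull_minimal) (simp_all add: alg_join_def)
  moreover have "1 \<in> A \<squnion>\<^sub>a B"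
    using assms alg_join_superset[where A = A and B = B] unfolding star_subalgebra_def by blast
  ultimately show ?thesis using sub unfolding star_subalgebra_def subalgebra_def by blast
qed

lemma star_subalgebra_Im_part:
  assumes "star_subalgebra N" "x \<in> N"
  shows "Im_part x \<in> N"
proof -
  have "Im_part x = (1 / (2 * \<i>)) *\<^sub>C (x + (- 1) *\<^sub>C star x)"
    using scaleC_minus_left[of 1 "star x"] by (simp add: Im_part_def)
  with assms show ?thesis unfolding star_subalgebra_def by metis
qed

text \<open>Supplies the connected domain for the identity theorem; it reaches below the real axis,
  so that \<open>z = 0\<close> is an interior point.\<close>

lemma upper_half_shift:
  assumes "star_subalgebra N" "a \<in> \<H>\<^sub>+ N"
  obtains \<epsilon> where "0 < \<epsilon>" "\<And>z. - \<epsilon> < Im z \<Longrightarrow> a + z *\<^sub>C 1 \<in> \<H>\<^sub>+ N"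
proof -
  obtain \<epsilon> where a: "a \<in> N" and \<epsilon>: "0 < \<epsilon>" "positive_elem (Im_part a - \<epsilon> *\<^sub>R 1)"
    using assms(2) by (auto simp: upper_half_def)
  have "a + z *\<^sub>C 1 \<in> \<H>\<^sub>+ N" if "- \<epsilon> < Im z" for z
  proof -
    have "Im_part (a + z *\<^sub>C 1) - (\<epsilon> + Im z) *\<^sub>R 1 = Im_part a - \<epsilon> *\<^sub>R 1"
      by (simp add: Im_part_add Im_part_scaleC_one scaleR_add_left)
    with \<epsilon>(2) have "positive_elem (Im_part (a + z *\<^sub>C 1) - (\<epsilon> + Im z) *\<^sub>R 1)" by simp
    moreover have "a + z *\<^sub>C 1 \<in> N" using assms(1) a by (simp add: star_subalgebra_def)
    ultimately show ?thesis using that unfolding upper_half_def by (smt (verit) mem_Collect_eq)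
  qed
  with \<epsilon>(1) show thesis by (rule that)
qed

text \<open>Provides whole real lines inside the domain, along which \<open>F\<close> can be
  differentiated.\<close>

lemma upper_half_add_selfadjoint:
  assumes "star_subalgebra N" "a \<in> \<H>\<^sub>+ N" "h \<in> N" "star h = h"
  shows "a + t *\<^sub>R h \<in> \<H>\<^sub>+ N"
proof -
  have "Im_part (a + t *\<^sub>R h) = Im_part a"
    using assms(4) by (simp add: Im_part_add Im_part_selfadjoint star_scaleR)
  moreover have "a + t *\<^sub>R h \<in> N"
    using assms unfolding star_subalgebra_def upper_half_def by (metis (lifting) mem_Collect_eq scaleC_of_real)
  ultimately show ?thesis using assms(2) by (simp add: upper_half_def)
qed

section \<open>Alternating centred words and their closed span\<close>

locale free_with_amalgamation = wstar_rep \<pi>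
  for \<pi> :: "'a::cstar_algebra \<Rightarrow> 'h::complex_hilbert \<Rightarrow>\<^sub>L 'h" +
  fixes \<tau> :: "'a \<Rightarrow> complex" and A B C :: "'a set" and E_B E_AB :: "'a \<Rightarrow> 'a"
  assumes trace: "faithful_normal_trace_state \<pi> \<tau>"
    and B: "wstar_subalgebra \<pi> B"
    and A: "star_subalgebra A"
    and C: "star_subalgebra C"
    and E_B: "cond_exp \<pi> \<tau> B E_B"
    and E_AB: "cond_exp \<pi> \<tau> (A \<squnion>\<^sub>a B) E_AB"
    and free: "B_free E_B B A C"
begin

sublocale EB: conditional_expectation \<pi> \<tau> B E_B
  by unfold_locales (fact trace E_B)+

sublocale EAB: conditional_expectation \<pi> \<tau> "A \<squnion>\<^sub>a B" E_AB
  by unfold_locales (fact trace E_AB)+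

lemma generated_B: "wstar_generated \<pi> B = B"
  unfolding wstar_generated_def using B by (rule hull_same)

text \<open>Turns membership into a linear equation, which survives analytic continuation and
  differentiation.\<close>

lemma in_B_iff: "x \<in> B \<longleftrightarrow> E_B x = x"
  using EB.E_in[of x] EB.E_fix[of x] by (metis generated_B)

lemma E_B_in: "E_B x \<in> B"
  using EB.E_in[of x] by (simp only: generated_B)

definition L :: "bool \<Rightarrow> 'a set"
  where "L d = (if d then A \<squnion>\<^sub>a B else B \<squnion>\<^sub>a C)"

lemma subalgebra_L: "subalgebra (L d)"
  by (simp add: L_def subalgebra_alg_join)

lemma L_add: "x \<in> L d \<Longrightarrow> y \<in> L d \<Longrightarrow> x + y \<in> L d"
  and L_mult: "x \<in> L d \<Longrightarrow> y \<in> L d \<Longrightarrow> x * y \<in> L d"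
  and L_scaleC: "x \<in> L d \<Longrightarrow> c *\<^sub>C x \<in> L d"
  using subalgebra_L[of d] by (simp_all add: subalgebra_def)

lemma L_superset: "A \<subseteq> L True" "B \<subseteq> L d" "C \<subseteq> L False"
  by (simp_all add: L_def alg_join_superset)

lemma L_center: "x \<in> L d \<Longrightarrow> x - E_B x \<in> L d"
  using L_add[of x d "(- 1) *\<^sub>C E_B x"] L_scaleC[of "E_B x" d "- 1"] E_B_in[of x] L_superset(2)
  by (auto simp: scaleC_minus_left)

lemma E_B_center: "E_B (x - E_B x) = 0"
  by (simp add: EB.E_diff EB.E_idem)

text \<open>Alternating products of centred letters; \<open>d\<close> is the type of the leftmost letter, and the
  rightmost letter always comes from \<open>B \<squnion>\<^sub>a C\<close>.\<close>
inductive word :: "bool \<Rightarrow> 'a \<Rightarrow> bool" where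
  letter: "x \<in> L False \<Longrightarrow> E_B x = 0 \<Longrightarrow> word False x"
| cons: "x \<in> L d \<Longrightarrow> E_B x = 0 \<Longrightarrow> word (\<not> d) w \<Longrightarrow> word d (x * w)"

lemma E_B_word:
  assumes "word d w"
  shows "E_B w = 0"
proof -
  \<comment> \<open>Freeness is stated for lists of letters; \<open>hd ks = d\<close> is carried
    along so that prepending a letter preserves alternation.\<close>
  from assms have "\<exists>ks xs. w = prod_list xs \<and> xs \<noteq> [] \<and> length ks = length xs \<and> distinct_adj ks \<and>
      hd ks = d \<and> (\<forall>j<length xs. xs ! j \<in> L (ks ! j) \<and> E_B (xs ! j) = 0)"
  proof induction
    case (letter x)
    then show ?case by (intro exI[of _ "[False]"] exI[of _ "[x]"]) simp
  next
    case (cons x d w)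
    then obtain ks xs where *: "w = prod_list xs" "xs \<noteq> []" "length ks = length xs"
      "distinct_adj ks" "hd ks = (\<not> d)" "\<forall>j<length xs. xs ! j \<in> L (ks ! j) \<and> E_B (xs ! j) = 0"
      by auto
    then have "ks \<noteq> []" by auto
    then have "distinct_adj (d # ks)" using * by (cases ks) auto
    moreover have "(x # xs) ! j \<in> L ((d # ks) ! j) \<and> E_B ((x # xs) ! j) = 0"
      if "j < length (x # xs)" for j
      using that cons.hyps * by (cases j) auto
    ultimately show ?case
      using * by (intro exI[of _ "d # ks"] exI[of _ "x # xs"]) auto
  qed
  with free show ?thesis unfolding B_free_def free_amalg_def L_def by blast
qed

text \<open>The first letter absorbs \<open>b\<close> and stays centred by the module property of
  \<open>E_B\<close>.\<close>

lemma word_left_mult_B: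
  assumes "word d w" "b \<in> B"
  shows "word d (b * w)"
proof -
  have b: "b * x \<in> L d \<and> E_B (b * x) = 0" if "x \<in> L d" "E_B x = 0" for x d
    using that assms(2) L_superset(2) EB.E_left[of b x] L_mult[of b d x]
    by (auto simp: generated_B)
  from assms(1) show ?thesis
  proof cases
    case letter
    then show ?thesis using b by (simp add: word.letter)
  next
    case (cons x w')
    then show ?thesis using b word.cons[of "b * x" d w'] by (simp add: mult.assoc)
  qed
qed

text \<open>Closed in norm so that the contraction principle applies. \<open>subspace\<close> is
  meant over the reals; complex scalars are recovered from \<open>B\<close>.\<close>

definition K :: "'a set"
  where "K = (\<lambda>S. subspace S \<and> closed S) hull {w. \<exists>d. word d w}"

lemma subspace_K: "subspace K" and closed_K: "closed K"
proof -
  have "subspace K \<and> closed K"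
    unfolding K_def by (rule hull_in) (auto intro: subspace_Inter closed_Inter)
  then show "subspace K" "closed K" by simp_all
qed

lemma word_in_K: "word d w \<Longrightarrow> w \<in> K"
  unfolding K_def by (rule hull_inc) blast

text \<open>The preimage of a closed subspace under a bounded linear map is a closed subspace, so it
  suffices to test words.\<close>

lemma K_induct:
  assumes "k \<in> K" "bounded_linear f" "subspace S" "closed S" "\<And>d w. word d w \<Longrightarrow> f w \<in> S"
  shows "f k \<in> S"
proof -
  interpret f: bounded_linear f by fact
  have "subspace {x. f x \<in> S}"
    using assms(3) by (auto simp: subspace_def f.add f.scaleR f.zero)
  moreover have "closed {x. f x \<in> S}"
    using continuous_closed_vimage[OF assms(4), of f] f.continuous
    by (simp add: vimage_def linear_continuous_at[OF assms(2)])
  ultimately have "K \<subseteq> {x. f x \<in> S}"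
    unfolding K_def using assms(5) by (intro hull_minimal) auto
  with assms(1) show ?thesis by blast
qed

lemma E_B_K: "k \<in> K \<Longrightarrow> E_B k = 0"
  using K_induct[OF _ EB.bounded_linear_E, of k "{0}"] E_B_word by (simp add: subspace_def)

text \<open>The centred part of \<open>x\<close> prolongs the word, while \<open>E_B x\<close> is
  absorbed by the first letter of \<open>w\<close>.\<close>

lemma letter_mult_word:
  assumes "x \<in> L d" "word (\<not> d) w"
  shows "x * w \<in> K"
proof -
  have "word d ((x - E_B x) * w)"
    using assms by (intro word.cons L_center E_B_center)
  moreover have "word (\<not> d) (E_B x * w)"
    using assms(2) E_B_in by (rule word_left_mult_B)
  ultimately have "(x - E_B x) * w + E_B x * w \<in> K"
    by (intro subspace_add[OF subspace_K] word_in_K)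
  then show ?thesis by (simp add: left_diff_distrib)
qed

lemma left_mult_K:
  assumes "a \<in> A \<squnion>\<^sub>a B" "k \<in> K"
  shows "a * k \<in> K"
proof (rule K_induct[OF assms(2) bounded_linear_mult_right subspace_K closed_K])
  have a: "a \<in> L True" using assms(1) by (simp add: L_def)
  fix d w assume w: "word d w"
  show "a * w \<in> K"
  proof (cases d)
    \<comment> \<open>A word starting in \<open>A \<squnion>\<^sub>a B\<close> is never a single
      letter, so a nonempty rest \<open>w'\<close> of the other type remains after merging
      \<open>a * x\<close>.\<close>
    case True
    with w obtain x w' where "w = x * w'" "x \<in> L True" "word False w'"
      by cases auto
    then show ?thesis
      using letter_mult_word[of "a * x" True w'] L_mult[OF a] by (simp add: mult.assoc)
  next
    case False
    then show ?thesis using letter_mult_word[OF a] w by simp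
  qed
qed

text \<open>Only a one-letter word can acquire a \<open>B\<close>-component under multiplication by
  \<open>c\<close>; in all other cases \<open>c * w\<close> is in \<open>K\<close> and the
  subtracted term is 0.\<close>

lemma centered_left_mult_K:
  assumes "c \<in> B \<squnion>\<^sub>a C" "k \<in> K"
  shows "c * k - E_B (c * k) \<in> K"
proof (rule K_induct[OF assms(2) _ subspace_K closed_K])
  show "bounded_linear (\<lambda>k. c * k - E_B (c * k))"
    by (intro bounded_linear_sub bounded_linear_mult_right
        bounded_linear_compose[OF EB.bounded_linear_E])
  have c: "c \<in> L False" using assms(1) by (simp add: L_def)
  fix d w assume w: "word d w"
  show "c * w - E_B (c * w) \<in> K"
  proof (cases d)
    case True
    then have "c * w \<in> K" using letter_mult_word[OF c] w by simp
    then show ?thesis by (simp add: E_B_K)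
  next
    case False
    from w show ?thesis
    proof cases
      case letter
      then have "word False (c * w - E_B (c * w))"
        using L_mult[OF c] by (intro word.letter L_center E_B_center)
      then show ?thesis by (rule word_in_K)
    next
      case (cons x w')
      then have "c * w \<in> K"
        using letter_mult_word[of "c * x" False w'] L_mult[OF c] False by (simp add: mult.assoc)
      then show ?thesis by (simp add: E_B_K)
    qed
  qed
qed

text \<open>For \<open>m\<close> in \<open>A \<squnion>\<^sub>a B\<close> the product
  \<open>m * k\<close> stays in \<open>K\<close>, so
  \<open>\<tau> (m * k) = \<tau> (E_B (m * k)) = 0\<close>.\<close>

lemma E_AB_K:
  assumes "k \<in> K"
  shows "E_AB k = 0"
proof (rule EAB.E_eq_zero)
  show "star_subalgebra (A \<squnion>\<^sub>a B)"
    using A B by (intro star_subalgebra_alg_join) (simp_all add: wstar_subalgebra_def)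
  fix m assume "m \<in> A \<squnion>\<^sub>a B"
  then have "E_B (m * k) = 0" using assms by (intro E_B_K left_mult_K)
  then have "\<tau> (m * k) = \<tau> 0" by (metis EB.trace_E)
  then show "\<tau> (m * k) = 0"
    using EB.trace trace unfolding faithful_normal_trace_state_def
    by (metis mult_zero_left scaleC_zero_left)
qed

text \<open>For \<open>z\<close> large the equation \<open>(z + a + c) (1 + k) = z + a + \<beta>\<close> has a solution with
  \<open>k \<in> K\<close> and \<open>\<beta> \<in> B\<close>; then \<open>1 + k = (z + a + c)\<^sup>-\<^sup>1 (z + a + \<beta>)\<close>, and \<open>E_AB\<close> kills \<open>k\<close>.\<close>
lemma subordination_perturbative:
  assumes a: "a \<in> A" and c: "c \<in> C" and z: "3 * norm (a + c) < cmod z"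
    and R: "two_sided_inverse (a + z *\<^sub>C 1 + c) R"
  obtains \<beta> where "\<beta> \<in> B" "E_AB R * (a + z *\<^sub>C 1 + \<beta>) = 1"
proof -
  define P where "P x = x - E_B x" for x
  \<comment> \<open>The equation amounts to
    \<open>z *\<^sub>C k + (a + c) * k + c = \<beta>\<close>. Applying \<open>P\<close> removes
    \<open>\<beta>\<close> and fixes \<open>k\<close>, leaving \<open>f k = k\<close>.\<close>
  define f where "f k = (- (1 / z)) *\<^sub>C P ((a + c) * k + c)" for k
  have a': "a \<in> A \<squnion>\<^sub>a B" and c': "c \<in> B \<squnion>\<^sub>a C"
    using a c alg_join_superset by blast+
  have z0: "cmod z > 0" using z norm_ge_zero[of "a + c"] by linarith
  have P_diff: "P x - P y = P (x - y)" for x y by (simp add: P_def EB.E_diff)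
  \<comment> \<open>Here 3 = 1 + 2, with 2 from \<open>norm_E_le\<close>; this is the 3 in the lower
    bound on \<open>cmod z\<close>.\<close>
  have P_le: "norm (P x) \<le> 3 * norm x" for x
    using norm_triangle_ineq4[of x "E_B x"] EB.norm_E_le[of x] by (simp add: P_def)
  have fK: "f k \<in> K" if "k \<in> K" for k
  proof -
    have "a * k \<in> K" using a' that by (rule left_mult_K)
    moreover have "c * k - E_B (c * k) \<in> K" using c' that by (rule centered_left_mult_K)
    moreover have "word False (c - E_B c)"
      using c' by (intro word.letter L_center E_B_center) (simp add: L_def)
    then have "c - E_B c \<in> K" by (rule word_in_K)
    ultimately have "a * k + (c * k - E_B (c * k)) + (c - E_B c) \<in> K"
      by (intro subspace_add[OF subspace_K])
    moreover have "P ((a + c) * k + c) = a * k + (c * k - E_B (c * k)) + (c - E_B c)"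
      using E_B_K[OF \<open>a * k \<in> K\<close>] by (simp add: P_def EB.E_add distrib_right)
    ultimately have PK: "P ((a + c) * k + c) \<in> K" by simp
    \<comment> \<open>Complex scalars act through \<open>w *\<^sub>C 1\<close>, which belongs to
      \<open>B\<close>.\<close>
    have "w *\<^sub>C k \<in> K" if "k \<in> K" for w k
    proof (rule K_induct[OF that bounded_linear_scaleC subspace_K closed_K])
      fix d v assume "word d v"
      moreover have "w *\<^sub>C 1 \<in> B"
        using B unfolding wstar_subalgebra_def star_subalgebra_def by blast
      ultimately have "word d ((w *\<^sub>C 1) * v)" by (rule word_left_mult_B)
      then show "w *\<^sub>C v \<in> K" using word_in_K by (fastforce simp: mult_scaleC_left)
    qed
    with PK show ?thesis by (simp add: f_def)
  qed
  have "\<exists>!k\<in>K. f k = k"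
  proof (rule Banach_fix[where c = "3 * norm (a + c) / cmod z"])
    show "complete K" using closed_K by (simp add: complete_eq_closed)
    show "K \<noteq> {}" using subspace_0[OF subspace_K] by blast
    show "3 * norm (a + c) / cmod z < 1" using z z0 by simp
    fix k l
    have "f k - f l = (- (1 / z)) *\<^sub>C P ((a + c) * (k - l))"
      unfolding f_def by (simp add: P_diff flip: scaleC_diff_right right_diff_distrib)
    then have "dist (f k) (f l) \<le> 1 / cmod z * (3 * norm ((a + c) * (k - l)))"
      using P_le by (simp add: dist_norm norm_scaleC norm_divide divide_right_mono)
    also have "\<dots> \<le> 1 / cmod z * (3 * (norm (a + c) * norm (k - l)))"
      by (intro mult_left_mono norm_mult_ineq) auto
    finally show "dist (f k) (f l) \<le> 3 * norm (a + c) / cmod z * dist k l"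
      by (simp add: dist_norm)
  qed (use fK in auto)
  then obtain k where k: "k \<in> K" "f k = k" by blast
  \<comment> \<open>The fixed point equation reads \<open>z *\<^sub>C k = E_B y - y\<close>, so the
    desired \<open>\<beta>\<close> is \<open>E_B y\<close>.\<close>
  define y where "y = (a + c) * k + c"
  have "z *\<^sub>C k = z *\<^sub>C f k" using k by simp
  also have "\<dots> = - P y"
    using z0 by (simp add: f_def y_def scaleC_scaleC scaleC_minus_left scaleC_minus_right)
  finally have zk: "z *\<^sub>C k = E_B y - y" by (simp add: P_def)
  have "(a + z *\<^sub>C 1 + c) * (1 + k) = a + z *\<^sub>C 1 + y + z *\<^sub>C k"
    by (simp add: y_def algebra_simps mult_scaleC_left)
  also have "\<dots> = a + z *\<^sub>C 1 + E_B y" by (simp add: zk)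
  finally have "R * (a + z *\<^sub>C 1 + E_B y) = 1 + k"
    using R unfolding two_sided_inverse_def by (metis mult.assoc mult_1_left)
  then have "E_AB (R * (a + z *\<^sub>C 1 + E_B y)) = 1"
    using k by (simp add: EAB.E_add EAB.E_one E_AB_K)
  moreover have "a + z *\<^sub>C 1 + E_B y \<in> wstar_generated \<pi> (A \<squnion>\<^sub>a B)"
  proof -
    have "a + z *\<^sub>C 1 + E_B y \<in> L True"
      using a B L_superset E_B_in[of y]
      by (intro L_add L_scaleC) (auto simp: wstar_subalgebra_def star_subalgebra_def)
    then show ?thesis using EAB.W_superset by (auto simp: L_def)
  qed
  ultimately have "E_AB R * (a + z *\<^sub>C 1 + E_B y) = 1" by (simp add: EAB.E_right)
  with E_B_in show thesis by (rule that)
qed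

section \<open>The subordination function\<close>

definition F :: "'a \<times> 'a \<Rightarrow> 'a"
  where "F p = inv_elem (E_AB (inv_elem (fst p + snd p))) - fst p"

text \<open>The lower bounds of the imaginary parts add up; for the expectation the two positive
  remainders enter separately.\<close>

lemma invertible_resolvent:
  assumes "a \<in> \<H>\<^sub>+ A" "c \<in> \<H>\<^sub>+ C"
  shows "invertible_elem (a + c)" "invertible_elem (E_AB (inv_elem (a + c)))"
proof -
  obtain \<epsilon> \<delta> where \<epsilon>: "0 < \<epsilon>" "positive_elem (Im_part a - \<epsilon> *\<^sub>R 1)"
    and \<delta>: "0 < \<delta>" "positive_elem (Im_part c - \<delta> *\<^sub>R 1)"
    using assms by (auto simp: upper_half_def)
  have Im: "Im_part (a + c) = (\<epsilon> + \<delta>) *\<^sub>R 1 + (Im_part a - \<epsilon> *\<^sub>R 1) + (Im_part c - \<delta> *\<^sub>R 1)"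
    by (simp add: Im_part_add algebra_simps)
  show inv: "invertible_elem (a + c)"
  proof (rule invertible_of_Im_bounded_below)
    show "0 < \<epsilon> + \<delta>" using \<epsilon> \<delta> by simp
    show "(\<epsilon> + \<delta>) * (norm v)\<^sup>2 \<le> qf v (Im_part (a + c))" for v
      unfolding Im qf_add[of v "_ + _"] qf_add[of v "(\<epsilon> + \<delta>) *\<^sub>R 1"]
      using qf_positive[OF \<epsilon>(2), of v] qf_positive[OF \<delta>(2), of v]
      by (simp add: qf_scaleR qf_one)
  qed
  show "invertible_elem (E_AB (inv_elem (a + c)))"
    using \<epsilon> \<delta> two_sided_inverse_inv_elem[OF inv]
    by (intro EAB.invertible_E_inverse[OF _ \<epsilon>(2) \<delta>(2) Im]) auto
qed

text \<open>The chain rule through two inversions, whose minus signs cancel.\<close>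

definition F_deriv :: "'a \<times> 'a \<Rightarrow> 'a \<times> 'a \<Rightarrow> 'a"
  where "F_deriv p h =
    (let R = inv_elem (fst p + snd p); G = inv_elem (E_AB R)
     in G * E_AB (R * (fst h + snd h) * R) * G - fst h)"

lemma F_has_derivative:
  assumes "a \<in> \<H>\<^sub>+ A" "c \<in> \<H>\<^sub>+ C"
  shows "(F has_derivative F_deriv (a, c)) (at (a, c))"
proof -
  define R where "R = inv_elem (a + c)"
  define G where "G = inv_elem (E_AB R)"
  have R: "two_sided_inverse (a + c) R" and G: "two_sided_inverse (E_AB R) G"
    using invertible_resolvent[OF assms] two_sided_inverse_inv_elem by (simp_all add: R_def G_def)
  have "((\<lambda>p. fst p + snd p) has_derivative (\<lambda>h. fst h + snd h)) (at (a, c))"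
    by (auto intro!: derivative_eq_intros)
  then have "((\<lambda>p. inv_elem (fst p + snd p)) has_derivative (\<lambda>h. - (R * (fst h + snd h) * R)))
      (at (a, c))"
    by (rule has_derivative_compose[where g = inv_elem and g' = "\<lambda>h. - (R * h * R)"])
      (use has_derivative_inv_elem[OF R] in simp)
  then have "((\<lambda>p. E_AB (inv_elem (fst p + snd p))) has_derivative
      (\<lambda>h. E_AB (- (R * (fst h + snd h) * R)))) (at (a, c))"
    by (rule bounded_linear.has_derivative[OF EAB.bounded_linear_E])
  then have "((\<lambda>p. inv_elem (E_AB (inv_elem (fst p + snd p)))) has_derivative
      (\<lambda>h. - (G * E_AB (- (R * (fst h + snd h) * R)) * G))) (at (a, c))"
    by (rule has_derivative_compose[where g = inv_elem and g' = "\<lambda>h. - (G * h * G)"])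
      (use has_derivative_inv_elem[OF G] in \<open>simp add: R_def\<close>)
  then have "(F has_derivative (\<lambda>h. - (G * E_AB (- (R * (fst h + snd h) * R)) * G) - fst h))
      (at (a, c))"
    unfolding F_def by (intro has_derivative_diff has_derivative_fst has_derivative_ident)
  moreover have "F_deriv (a, c) = (\<lambda>h. - (G * E_AB (- (R * (fst h + snd h) * R)) * G) - fst h)"
    by (simp add: fun_eq_iff F_deriv_def Let_def R_def G_def EAB.E_neg)
  ultimately show ?thesis by simp
qed

lemma F_deriv_add: "F_deriv p (h + k) = F_deriv p h + F_deriv p k"
  by (simp add: F_deriv_def Let_def EAB.E_add algebra_simps)

lemma F_deriv_scaleC: "F_deriv p (z *\<^sub>C h, z *\<^sub>C k) = z *\<^sub>C F_deriv p (h, k)"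
  by (simp add: F_deriv_def Let_def EAB.E_scaleC mult_scaleC_left mult_scaleC_right
      scaleC_diff_right flip: scaleC_add_right)

lemma F_in_B:
  assumes a: "a \<in> \<H>\<^sub>+ A" and c: "c \<in> \<H>\<^sub>+ C"
  shows "F (a, c) \<in> B"
proof -
  have aA: "a \<in> A" and cC: "c \<in> C" using a c by (simp_all add: upper_half_def)
  obtain \<epsilon> where \<epsilon>: "0 < \<epsilon>" and shift: "\<And>z. - \<epsilon> < Im z \<Longrightarrow> a + z *\<^sub>C 1 \<in> \<H>\<^sub>+ A"
    using upper_half_shift[OF A a] by metis
  define \<Phi> where "\<Phi> z = F (a + z *\<^sub>C 1, c) - E_B (F (a + z *\<^sub>C 1, c))" for z
  \<comment> \<open>The bound is imposed on \<open>Im z\<close> rather than \<open>cmod z\<close>,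
    so that the region is a half-plane on which \<open>a + z *\<^sub>C 1\<close> stays in the
    domain.\<close>
  have far: "\<Phi> z = 0" if z: "3 * norm (a + c) < Im z" for z
  proof -
    have "0 \<le> Im z" using z norm_ge_zero[of "a + c"] by linarith
    then have az: "a + z *\<^sub>C 1 \<in> \<H>\<^sub>+ A" using \<epsilon> by (intro shift) simp
    define R where "R = inv_elem (a + z *\<^sub>C 1 + c)"
    have R: "two_sided_inverse (a + z *\<^sub>C 1 + c) R"
      and G: "two_sided_inverse (E_AB R) (inv_elem (E_AB R))"
      using invertible_resolvent[OF az c] two_sided_inverse_inv_elem by (simp_all add: R_def)
    have "3 * norm (a + c) < cmod z"
      using z abs_Im_le_cmod[of z] by linarith
    then obtain \<beta> where \<beta>: "\<beta> \<in> B" "E_AB R * (a + z *\<^sub>C 1 + \<beta>) = 1"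
      using subordination_perturbative[OF aA cC _ R] by blast
    \<comment> \<open>\<open>E_AB R\<close> is already known to be invertible, so a right inverse is
      the inverse.\<close>
    then have "inv_elem (E_AB R) = a + z *\<^sub>C 1 + \<beta>"
      using G unfolding two_sided_inverse_def by (metis mult.assoc mult_1_left mult_1_right)
    then have "F (a + z *\<^sub>C 1, c) = \<beta>" by (simp add: F_def R_def)
    then show ?thesis using \<beta>(1) by (simp add: \<Phi>_def in_B_iff)
  qed
  \<comment> \<open>Matrix coefficients reduce the claim to the scalar identity theorem on
    \<open>- \<epsilon> < Im z\<close>, starting from the far half-plane.\<close>
  have "cinner u (\<pi> (\<Phi> 0) v) = 0" for u v
  proof (rule analytic_continuation_open[where f = "\<lambda>z. cinner u (\<pi> (\<Phi> z) v)"
        and g = "\<lambda>_. 0" and s' = "{z. - \<epsilon> < Im z}" and s = "{z. 3 * norm (a + c) < Im z}"])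
    show "open {z. - \<epsilon> < Im z}" "open {z. 3 * norm (a + c) < Im z}"
      by (simp_all add: open_halfspace_Im_gt)
    show "connected {z. - \<epsilon> < Im z}"
      by (intro convex_connected convex_halfspace_Im_gt)
    have "\<i> * of_real (3 * norm (a + c) + 1) \<in> {z. 3 * norm (a + c) < Im z}" by simp
    then show "{z. 3 * norm (a + c) < Im z} \<noteq> {}" by blast
    show "{z. 3 * norm (a + c) < Im z} \<subseteq> {z. - \<epsilon> < Im z}"
    proof
      fix z assume "z \<in> {z. 3 * norm (a + c) < Im z}"
      with \<epsilon> norm_ge_zero[of "a + c"] show "z \<in> {z. - \<epsilon> < Im z}"
        unfolding mem_Collect_eq by linarith
    qed
    show "cinner u (\<pi> (\<Phi> z) v) = 0" if "z \<in> {z. 3 * norm (a + c) < Im z}" for z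
      using far that linear_0[OF bounded_linear.linear[OF bounded_linear_form]] by simp
    define \<phi> where "\<phi> x = cinner u (\<pi> (x - E_B x) v)" for x
    have \<phi>: "bounded_linear \<phi>"
      unfolding \<phi>_def
      by (intro bounded_linear_compose[OF bounded_linear_form] bounded_linear_sub
          bounded_linear_ident EB.bounded_linear_E)
    have \<phi>_scaleC: "\<phi> (w *\<^sub>C x) = w * \<phi> x" for w x
      by (simp add: \<phi>_def EB.E_scaleC form_scaleC flip: scaleC_diff_right)
    have "((\<lambda>z. \<phi> (F (a + z *\<^sub>C 1, c))) has_field_derivative
        \<phi> (F_deriv (a + z *\<^sub>C 1, c) (1, 0))) (at z)" if "- \<epsilon> < Im z" for z
    proof -
      have "((\<lambda>z. (a + z *\<^sub>C 1, c)) has_derivative (\<lambda>w. (0 + w *\<^sub>C 1, 0))) (at z)"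
        by (intro has_derivative_Pair has_derivative_add has_derivative_const
            bounded_linear_imp_has_derivative bounded_linear_scaleC_left)
      then have "((\<lambda>z. F (a + z *\<^sub>C 1, c)) has_derivative
          (\<lambda>w. F_deriv (a + z *\<^sub>C 1, c) (0 + w *\<^sub>C 1, 0))) (at z)"
        by (rule has_derivative_compose[where g = F and g' = "F_deriv (a + z *\<^sub>C 1, c)"])
          (rule F_has_derivative[OF shift[OF that] c])
      then have "((\<lambda>z. \<phi> (F (a + z *\<^sub>C 1, c))) has_derivative
          (\<lambda>w. \<phi> (F_deriv (a + z *\<^sub>C 1, c) (0 + w *\<^sub>C 1, 0)))) (at z)"
        by (rule bounded_linear.has_derivative[OF \<phi>])
      \<comment> \<open>Complex linearity turns the real derivative into multiplication by a complex
        number.\<close>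
      moreover have "\<phi> (F_deriv (a + z *\<^sub>C 1, c) (0 + w *\<^sub>C 1, 0)) =
          \<phi> (F_deriv (a + z *\<^sub>C 1, c) (1, 0)) * w" for w
        using F_deriv_scaleC[of _ w 1 0] by (simp add: \<phi>_scaleC mult.commute)
      ultimately show ?thesis by (simp add: has_field_derivative_def)
    qed
    then show "(\<lambda>z. cinner u (\<pi> (\<Phi> z) v)) holomorphic_on {z. - \<epsilon> < Im z}"
      unfolding \<Phi>_def \<phi>_def[symmetric]
      by (auto simp: holomorphic_on_open open_halfspace_Im_gt)
  qed (use \<epsilon> in \<open>simp_all add: holomorphic_on_const\<close>)
  then have "\<Phi> 0 = 0" by (rule eq_zero_of_form)
  then show ?thesis by (simp add: \<Phi>_def in_B_iff)
qed

text \<open>Self-adjoint directions stay in the upper half-planes; the rest is complex linearity.\<close>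
lemma F_deriv_in_B:
  assumes a: "a \<in> \<H>\<^sub>+ A" and c: "c \<in> \<H>\<^sub>+ C" and "h \<in> A" "k \<in> C"
  shows "F_deriv (a, c) (h, k) \<in> B"
proof -
  have sa: "E_B (F_deriv (a, c) (h, k)) = F_deriv (a, c) (h, k)"
    if h: "h \<in> A" "star h = h" and k: "k \<in> C" "star k = k" for h k
  proof -
    define P where "P x = x - E_B x" for x
    have P: "bounded_linear P"
      unfolding P_def by (intro bounded_linear_sub bounded_linear_ident EB.bounded_linear_E)
    have "((\<lambda>t::real. (a, c) + t *\<^sub>R (h, k)) has_derivative (\<lambda>t. 0 + t *\<^sub>R (h, k))) (at 0)"
      by (intro has_derivative_add has_derivative_const has_derivative_scaleR_left
          has_derivative_ident)
    then have "((\<lambda>t. F ((a, c) + t *\<^sub>R (h, k))) has_derivative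
        (\<lambda>t. F_deriv (a, c) (0 + t *\<^sub>R (h, k)))) (at 0)"
      using has_derivative_compose[where f = "\<lambda>t::real. (a, c) + t *\<^sub>R (h, k)" and x = 0
          and s = UNIV and g = F and g' = "F_deriv (a, c)"] F_has_derivative[OF a c]
      by simp
    then have "((\<lambda>t. P (F ((a, c) + t *\<^sub>R (h, k)))) has_derivative
        (\<lambda>t. P (F_deriv (a, c) (0 + t *\<^sub>R (h, k))))) (at 0)"
      by (rule bounded_linear.has_derivative[OF P])
    \<comment> \<open>The line stays in the domain for every real \<open>t\<close>, so
      \<open>P\<close> composed with \<open>F\<close> is constant along it and has derivative
      0.\<close>
    moreover have "P (F ((a, c) + t *\<^sub>R (h, k))) = 0" for t
      using F_in_B[OF upper_half_add_selfadjoint[OF A a h] upper_half_add_selfadjoint[OF C c k]]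
      by (simp add: P_def in_B_iff)
    ultimately have "((\<lambda>t::real. 0) has_derivative
        (\<lambda>t. P (F_deriv (a, c) (0 + t *\<^sub>R (h, k))))) (at 0)" by simp
    then have "(\<lambda>t::real. P (F_deriv (a, c) (0 + t *\<^sub>R (h, k)))) = (\<lambda>t. 0)"
      by (rule has_derivative_unique[OF _ has_derivative_const])
    from fun_cong[OF this, of 1] show ?thesis by (simp add: P_def)
  qed
  have "(h, k) = (Im_part (\<i> *\<^sub>C h), Im_part (\<i> *\<^sub>C k)) + (\<i> *\<^sub>C Im_part h, \<i> *\<^sub>C Im_part k)"
    using Re_Im_decomposition(1)[of h] Re_Im_decomposition(1)[of k] by simp
  then have split: "F_deriv (a, c) (h, k) = F_deriv (a, c) (Im_part (\<i> *\<^sub>C h), Im_part (\<i> *\<^sub>C k))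
      + \<i> *\<^sub>C F_deriv (a, c) (Im_part h, Im_part k)"
    by (simp only: F_deriv_add F_deriv_scaleC)
  have "Im_part h \<in> A" "Im_part k \<in> C" "Im_part (\<i> *\<^sub>C h) \<in> A" "Im_part (\<i> *\<^sub>C k) \<in> C"
    using A C assms(3,4)
    by (auto intro!: star_subalgebra_Im_part simp: star_subalgebra_def)
  then show ?thesis
    by (simp add: in_B_iff split EB.E_add EB.E_scaleC sa Re_Im_decomposition(2))
qed

text \<open>\<open>F\<close> is differentiable in the ambient space at these points; restricting the
  derivative to \<open>A \<times> C\<close> keeps all estimates, and its values lie in
  \<open>B\<close> by \<open>F_deriv_in_B\<close>.\<close>

lemma holomorphic_F: "holomorphic_pair A C B (\<H>\<^sub>+ A \<times> \<H>\<^sub>+ C) F"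
  unfolding holomorphic_pair_def
proof (intro conjI ballI)
  show "F ` (\<H>\<^sub>+ A \<times> \<H>\<^sub>+ C) \<subseteq> B" using F_in_B by auto
  fix p assume "p \<in> \<H>\<^sub>+ A \<times> \<H>\<^sub>+ C"
  then obtain a c where p: "p = (a, c)" "a \<in> \<H>\<^sub>+ A" "c \<in> \<H>\<^sub>+ C" by auto
  have D: "bounded_linear (F_deriv p)"
    "((\<lambda>h. norm (F (p + h) - F p - F_deriv p h) / norm h) \<longlongrightarrow> 0) (at 0)"
    using F_has_derivative[OF p(2,3)] unfolding p(1) has_derivative_at by auto
  obtain M where "\<And>h. norm (F_deriv p h) \<le> norm h * M"
    using bounded_linear.bounded[OF D(1)] by blast
  then have "\<exists>M. \<forall>h\<in>A \<times> C. norm (F_deriv p h) \<le> M * norm h" by (metis mult.commute)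
  moreover have "F_deriv p ` (A \<times> C) \<subseteq> B" using F_deriv_in_B[OF p(2,3)] p(1) by auto
  moreover have "((\<lambda>h. norm (F (p + h) - F p - F_deriv p h) / norm h) \<longlongrightarrow> 0) (at 0 within A \<times> C)"
    using D(2) by (rule tendsto_within_subset) simp
  ultimately show "\<exists>D. D ` (A \<times> C) \<subseteq> B \<and>
        (\<forall>h\<in>A \<times> C. \<forall>k\<in>A \<times> C. D (h + k) = D h + D k) \<and>
        (\<forall>z. \<forall>v\<in>A. \<forall>v'\<in>C. D (z *\<^sub>C v, z *\<^sub>C v') = z *\<^sub>C D (v, v')) \<and>
        (\<exists>M. \<forall>h\<in>A \<times> C. norm (D h) \<le> M * norm h) \<and>
        ((\<lambda>h. norm (F (p + h) - F p - D h) / norm h) \<longlongrightarrow> 0) (at 0 within A \<times> C)"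
    by (intro exI[of _ "F_deriv p"] conjI) (simp_all add: F_deriv_add F_deriv_scaleC)
qed

lemma subordination:
  assumes "a \<in> \<H>\<^sub>+ A" "c \<in> \<H>\<^sub>+ C"
  shows "invertible_elem (a + F (a, c))" "E_AB (inv_elem (a + c)) = inv_elem (a + F (a, c))"
proof -
  have "two_sided_inverse (a + F (a, c)) (E_AB (inv_elem (a + c)))"
    using two_sided_inverse_inv_elem[OF invertible_resolvent(2)[OF assms]]
    by (simp add: F_def two_sided_inverse_def)
  then show "invertible_elem (a + F (a, c))"
    "E_AB (inv_elem (a + c)) = inv_elem (a + F (a, c))"
    by (auto simp: invertible_elem_def inv_elem_eq)
qed

end

theorem theorem4p13:
  fixes \<pi> :: "'a::cstar_algebra \<Rightarrow> 'h::complex_hilbert \<Rightarrow>\<^sub>L 'h"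
    and \<tau> :: "'a \<Rightarrow> complex"
    and A B C :: "'a set"
    and E_B E_AB :: "'a \<Rightarrow> 'a"
  assumes "wstar_algebra \<pi>"
    and "faithful_normal_trace_state \<pi> \<tau>"
    and "wstar_subalgebra \<pi> B"
    and "star_subalgebra A"
    and "star_subalgebra C"
    and "cond_exp \<pi> \<tau> B E_B"
    and "cond_exp \<pi> \<tau> (A \<squnion>\<^sub>a B) E_AB"
    and "B_free E_B B A C"
  shows "\<exists>F. holomorphic_pair A C B (\<H>\<^sub>+ A \<times> \<H>\<^sub>+ C) F \<and>
           (\<forall>a\<in>\<H>\<^sub>+ A. \<forall>c\<in>\<H>\<^sub>+ C.
              invertible_elem (a + c) \<and> invertible_elem (a + F (a, c)) \<and>
              E_AB (inv_elem (a + c)) = inv_elem (a + F (a, c)))"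
proof -
  interpret free_with_amalgamation \<pi> \<tau> A B C E_B E_AB
    by unfold_locales (fact assms)+
  show ?thesis
    using holomorphic_F invertible_resolvent(1) subordination by blast
qed

end
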